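(* Let $u$ be a smooth strictly plurisubharmonic function on $\mathbb{C}^2$, so that $\omega_u:=dd^cu$ is a Kähler metric on the cone $\mathbb{C}^2\setminus\{0\}$, and let $u_0(z)=\frac12|z|^2$, $\omega_{u_0}:=dd^cu_0$. Then for all $R\in(0,\infty)$, $$\frac{\mathrm{MA}(u)(B_R)}{\mathrm{Vol}(B_R)}=\frac{\int_{B_R}\omega_u^2}{\int_{B_R}\omega_{u_0}^2}\;\le\;8R^{-3}\,\|ru_r\|_{L^\infty(\overline{B}_R)}\cdot\left(\frac{1}{|S_R|}\int_{S_R}u_r\right).$$
   Context: $B_R=\{z\in\mathbb{C}^2:|z|<R\}$, $S_R=\partial B_R$, $r=|z|$, $u_r=\partial_ru$ is the radial derivative, and the last factor is the average of $u_r$ over $S_R$. Conventions: $d=\partial+\bar\partial$, $d^c=\frac{i}{2}(\bar\partial-\partial)$, so $dd^c=i\partial\bar\partial$ and $\omega_{u_0}=\frac{i}{2}dz^0\wedge d\bar z^0+\frac{i}{2}dz^1\wedge d\bar z^1$ is the standard Euclidean Kähler form. $\mathrm{MA}(u)(B_R)=\int_{B_R}(dd^cu)^2=\int_{B_R}\omega_u^2$, and $\mathrm{Vol}(B_R)$ denotes the volume of $B_R$ measured by $\omega_{u_0}^2$, i.e. $\mathrm{Vol}(B_R)=\int_{B_R}\omega_{u_0}^2$. *)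

theory Defs
  imports "HOL-Probability.Essential_Supremum"
begin

primrec Ck :: "nat \<Rightarrow> ('a::euclidean_space \<Rightarrow> real) \<Rightarrow> bool" where
  "Ck 0 f \<longleftrightarrow> continuous_on UNIV f"
| "Ck (Suc k) f \<longleftrightarrow> f differentiable_on UNIV \<and>
     (\<forall>b\<in>Basis. Ck k (\<lambda>x. frechet_derivative f (at x) b))"

definition smooth :: "('a::euclidean_space \<Rightarrow> real) \<Rightarrow> bool" where
  "smooth f \<longleftrightarrow> (\<forall>k. Ck k f)"

type_synonym C2 = "complex ^ 2"

text \<open>Wirtinger derivatives: with \<open>z\<^sub>j = x\<^sub>j + i y\<^sub>j\<close>, the vectors \<^term>\<open>axis j 1\<close> and
  \<^term>\<open>axis j \<i>\<close> are the coordinate directions of \<open>x\<^sub>j\<close> and \<open>y\<^sub>j\<close>.\<close>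

definition wirt :: "2 \<Rightarrow> (C2 \<Rightarrow> complex) \<Rightarrow> C2 \<Rightarrow> complex" where
  "wirt j f z = (frechet_derivative f (at z) (axis j 1)
                 - \<i> * frechet_derivative f (at z) (axis j \<i>)) / 2"

definition wirt_bar :: "2 \<Rightarrow> (C2 \<Rightarrow> complex) \<Rightarrow> C2 \<Rightarrow> complex" where
  "wirt_bar j f z = (frechet_derivative f (at z) (axis j 1)
                     + \<i> * frechet_derivative f (at z) (axis j \<i>)) / 2"

text \<open>Strict plurisubharmonicity of a smooth function: its Levi form is positive definite at
  every point. The Levi form takes real values, so \<^const>\<open>Re\<close> discards nothing.\<close>

definition strictly_psh :: "(C2 \<Rightarrow> real) \<Rightarrow> bool" where
  "strictly_psh u \<longleftrightarrow> (\<forall>z \<zeta>. \<zeta> \<noteq> 0 \<longrightarrow>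
     0 < Re (\<Sum>j\<in>UNIV. \<Sum>k\<in>UNIV.
               wirt j (wirt_bar k (\<lambda>w. complex_of_real (u w))) z * \<zeta> $ j * cnj (\<zeta> $ k)))"

text \<open>A differential form is given by its values on tangent vectors, the first argument being the
  base point; wedge product and exterior derivative are normalised so that
  \<open>(\<alpha> \<and> \<beta>)(v, w) = \<alpha>(v) \<beta>(w) - \<alpha>(w) \<beta>(v)\<close> for 1-forms.\<close>

type_synonym 'b form1 = "C2 \<Rightarrow> C2 \<Rightarrow> 'b"
type_synonym form2 = "C2 \<Rightarrow> C2 \<Rightarrow> C2 \<Rightarrow> real"
type_synonym form4 = "C2 \<Rightarrow> C2 \<Rightarrow> C2 \<Rightarrow> C2 \<Rightarrow> C2 \<Rightarrow> real"

definition del :: "(C2 \<Rightarrow> complex) \<Rightarrow> complex form1" where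
  "del f z v = (\<Sum>j\<in>UNIV. wirt j f z * v $ j)"

definition delbar :: "(C2 \<Rightarrow> complex) \<Rightarrow> complex form1" where
  "delbar f z v = (\<Sum>j\<in>UNIV. wirt_bar j f z * cnj (v $ j))"

text \<open>\<open>d\<^sup>c = (i/2)(\<partial>bar - \<partial>)\<close>; on real functions it yields a real form, here made real-valued
  by \<^const>\<open>Re\<close>.\<close>

definition dc :: "(C2 \<Rightarrow> real) \<Rightarrow> real form1" where
  "dc u z v = Re (\<i> / 2 * (delbar (\<lambda>w. complex_of_real (u w)) z v
                           - del (\<lambda>w. complex_of_real (u w)) z v))"

definition ext_deriv :: "real form1 \<Rightarrow> form2" where
  "ext_deriv \<alpha> z v w = frechet_derivative (\<lambda>x. \<alpha> x w) (at z) v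
                      - frechet_derivative (\<lambda>x. \<alpha> x v) (at z) w"

definition wedge :: "form2 \<Rightarrow> form2 \<Rightarrow> form4" where
  "wedge \<alpha> \<beta> z a b c d =
       \<alpha> z a b * \<beta> z c d - \<alpha> z a c * \<beta> z b d + \<alpha> z a d * \<beta> z b c
     + \<alpha> z b c * \<beta> z a d - \<alpha> z b d * \<beta> z a c + \<alpha> z c d * \<beta> z a b"

text \<open>Integration of a top-degree form for the complex orientation \<open>(x\<^sub>1, y\<^sub>1, x\<^sub>2, y\<^sub>2)\<close>.\<close>

definition form_integral :: "C2 set \<Rightarrow> form4 \<Rightarrow> real" where
  "form_integral A \<Omega> = set_lebesgue_integral lborel A
     (\<lambda>z. \<Omega> z (axis 1 1) (axis 1 \<i>) (axis 2 1) (axis 2 \<i>))"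

definition omega :: "(C2 \<Rightarrow> real) \<Rightarrow> form2" where
  "omega u = ext_deriv (dc u)"

definition u0 :: "C2 \<Rightarrow> real" where
  "u0 z = (norm z)\<^sup>2 / 2"

definition MA :: "(C2 \<Rightarrow> real) \<Rightarrow> C2 set \<Rightarrow> real" where
  "MA u A = form_integral A (wedge (ext_deriv (dc u)) (ext_deriv (dc u)))"

text \<open>The volume measured by \<open>\<omega>\<^sub>u\<^sub>0 \<and> \<omega>\<^sub>u\<^sub>0\<close>, which is twice the Euclidean volume.\<close>

definition Vol :: "C2 set \<Rightarrow> real" where
  "Vol A = form_integral A (wedge (omega u0) (omega u0))"

definition radial_deriv :: "('a::real_normed_vector \<Rightarrow> real) \<Rightarrow> 'a \<Rightarrow> real" where
  "radial_deriv u z = deriv (\<lambda>t. u (t *\<^sub>R sgn z)) (norm z)"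

definition Linf_norm :: "'a::euclidean_space set \<Rightarrow> ('a \<Rightarrow> real) \<Rightarrow> real" where
  "Linf_norm A f = real_of_ereal (esssup (lebesgue_on A) (\<lambda>z. ereal \<bar>f z\<bar>))"

text \<open>Surface measure on the sphere of radius \<open>R > 0\<close> in \<open>n\<close>-dimensional Euclidean space, as in the
  polar coordinates formula: the measure of \<open>E\<close> is \<open>n / R\<close> times the Lebesgue measure of the
  cone \<open>{t x | x \<in> E, 0 < t < 1}\<close>, which is the preimage of \<open>E\<close> under radial projection.\<close>

definition surface_measure :: "real \<Rightarrow> 'a::euclidean_space measure" where
  "surface_measure R = scale_measure (ennreal (real DIM('a) / R))
     (distr (restrict_space lborel (ball 0 R - {0})) (restrict_space borel (sphere 0 R))
            (\<lambda>z. R *\<^sub>R sgn z))"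

definition sphere_average :: "real \<Rightarrow> ('a::euclidean_space \<Rightarrow> real) \<Rightarrow> real" where
  "sphere_average R f =
     1 / measure (surface_measure R) (sphere (0::'a) R) * (LINT z|surface_measure R. f z)"

end

theory Submission
  imports Defs
begin

text \<open>
  Let \<open>E\<close> be the Euler field, \<open>I = iE\<close>, and let \<open>X\<close>, \<open>Y = iX\<close> be the other two quaternionic rotation
  fields, so that \<open>I, X, Y\<close> is a frame of every sphere and derivatives along \<open>I, X, Y\<close> integrate to
  zero over spheres. With \<open>p = Eu = r u\<^sub>r\<close> and \<open>q = Iu\<close>, Stokes' theorem becomes the pointwise statement
  that \<open>r\<^sup>4\<close> times the Monge-Ampere density is an \<open>E\<close>-derivative up to tangential derivatives, and
  a multiple of the mass of \<open>B\<^sub>R\<close> is the integral over \<open>S\<^sub>R\<close> of \<open>2p \<omega>(X,Y) - (p\<^sup>2 - q\<^sup>2)\<close>.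
  Since \<open>\<omega>(X,Y) \<ge> 0\<close> has the same integral as \<open>p\<close>, the first term is at most \<open>2 sup\<bar>p\<bar> \<integral>p\<close>. For the
  second, \<open>E(p\<^sup>2 - q\<^sup>2)\<close> equals \<open>4p \<omega>(E,I)\<close> up to tangential derivatives, where \<open>\<omega>(E,I) \<ge> 0\<close> has half
  the integral of \<open>Ep\<close>; integrating in the radius gives \<open>\<integral>(p\<^sup>2 - q\<^sup>2) \<ge> -2 sup\<bar>p\<bar> \<integral>p\<close>. Together this
  is the claim with the constant 4 in place of 8.
\<close>

section \<open>Smooth functions and derivatives along linear vector fields\<close>

lemma Ck_SucD: "Ck (Suc k) f \<Longrightarrow> Ck k f"
proof (induction k arbitrary: f)
  case 0
  then show ?case by (simp add: differentiable_imp_continuous_on)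
next
  case (Suc k)
  then show ?case by (metis Ck.simps(2))
qed

lemma Ck_const: "Ck k (\<lambda>_. c)"
  by (induction k arbitrary: c) simp_all

lemma Ck_add:
  assumes "Ck k f" "Ck k g"
  shows "Ck k (\<lambda>x. f x + g x)"
  using assms
proof (induction k arbitrary: f g)
  case 0
  then show ?case by (simp add: continuous_on_add)
next
  case (Suc k)
  have d: "f differentiable at x" "g differentiable at x" for x
    using Suc.prems by (auto simp: differentiable_on_def)
  have "frechet_derivative (\<lambda>x. f x + g x) (at x) b
      = frechet_derivative f (at x) b + frechet_derivative g (at x) b" for x b
    by (rule fun_cong[OF frechet_derivative_at[symmetric]])
       (intro has_derivative_add d[unfolded frechet_derivative_works])
  then show ?case
    using Suc by (simp add: differentiable_on_add)
qed

lemma Ck_mult: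
  assumes "Ck k f" "Ck k g"
  shows "Ck k (\<lambda>x. f x * g x)"
  using assms
proof (induction k arbitrary: f g)
  case 0
  then show ?case by (simp add: continuous_on_mult)
next
  case (Suc k)
  have d: "f differentiable at x" "g differentiable at x" for x
    using Suc.prems by (auto simp: differentiable_on_def)
  have "frechet_derivative (\<lambda>x. f x * g x) (at x) b
      = f x * frechet_derivative g (at x) b + frechet_derivative f (at x) b * g x" for x b
    by (rule fun_cong[OF frechet_derivative_at[symmetric]])
       (intro has_derivative_mult d[unfolded frechet_derivative_works])
  moreover have "Ck k f" "Ck k g"
    using Suc.prems by (auto dest: Ck_SucD simp del: Ck.simps)
  ultimately show ?case
    using Suc by (simp add: differentiable_on_mult Ck_add)
qed

lemma Ck_linear:
  assumes "linear (f :: 'a::euclidean_space \<Rightarrow> real)"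
  shows "Ck k f"
proof (cases k)
  case 0
  then show ?thesis using assms by (simp add: linear_continuous_on linear_conv_bounded_linear)
next
  case (Suc j)
  have "(f has_derivative f) (at x)" for x
    using assms by (simp add: bounded_linear_imp_has_derivative linear_conv_bounded_linear)
  then have "frechet_derivative f (at x) = f" for x
    by (metis frechet_derivative_at)
  then show ?thesis
    using assms by (simp add: Suc Ck_const linear_imp_differentiable_on)
qed

lemma smooth_const: "smooth (\<lambda>_. c)"
  by (simp add: smooth_def Ck_const)

lemma smooth_add: "smooth f \<Longrightarrow> smooth g \<Longrightarrow> smooth (\<lambda>x. f x + g x)"
  by (simp add: smooth_def Ck_add)

lemma smooth_mult: "smooth f \<Longrightarrow> smooth g \<Longrightarrow> smooth (\<lambda>x. f x * g x)"
  by (simp add: smooth_def Ck_mult)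

lemma smooth_diff: "smooth f \<Longrightarrow> smooth g \<Longrightarrow> smooth (\<lambda>x. f x - g x)"
  using smooth_add[OF _ smooth_mult[OF smooth_const[of "-1"]], of f g] by simp

lemma smooth_power2: "smooth f \<Longrightarrow> smooth (\<lambda>x. (f x)\<^sup>2)"
  by (simp add: power2_eq_square smooth_mult)

lemma smooth_sum:
  assumes "\<And>i. i \<in> I \<Longrightarrow> smooth (f i)"
  shows "smooth (\<lambda>x. \<Sum>i\<in>I. f i x)"
  using assms by (induction I rule: infinite_finite_induct) (auto simp: smooth_const smooth_add)

lemma smooth_has_derivative:
  "smooth f \<Longrightarrow> (f has_derivative frechet_derivative f (at x)) (at x)"
  unfolding smooth_def
  by (metis Ck.simps(2) UNIV_I differentiable_on_def frechet_derivative_works)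

lemma smooth_partial:
  "smooth f \<Longrightarrow> b \<in> Basis \<Longrightarrow> smooth (\<lambda>x. frechet_derivative f (at x) b)"
  unfolding smooth_def by (metis Ck.simps(2))

lemma smooth_continuous_on: "smooth f \<Longrightarrow> continuous_on S f"
  unfolding smooth_def by (metis Ck.simps(1) continuous_on_subset subset_UNIV)

text \<open>\<open>Ck\<close> speaks of derivatives along \<open>Basis\<close> vectors only; this
  expansion carries smoothness over to arbitrary directions and to linear vector fields.\<close>

lemma frechet_derivative_Basis_sum:
  assumes "smooth f"
  shows "frechet_derivative f (at x) v = (\<Sum>b\<in>Basis. (v \<bullet> b) * frechet_derivative f (at x) b)"
proof -
  have "linear (frechet_derivative f (at x))"
    using smooth_has_derivative[OF assms] has_derivative_linear by blast
  then show ?thesis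
    using Linear_Algebra.linear_componentwise[of "frechet_derivative f (at x)" v 1] by simp
qed

lemma continuous_frechet_derivative:
  assumes "smooth f"
  shows "continuous_on UNIV (\<lambda>(x, v). frechet_derivative f (at x) v)"
proof -
  have "continuous_on UNIV (\<lambda>y :: 'a \<times> 'a. frechet_derivative f (at (fst y)) b)" if "b \<in> Basis" for b
    by (rule continuous_on_compose2[OF smooth_continuous_on[OF smooth_partial[OF assms that]]])
       (auto intro!: continuous_intros)
  then have "continuous_on UNIV (\<lambda>y :: 'a \<times> 'a. \<Sum>b\<in>Basis. (snd y \<bullet> b) * frechet_derivative f (at (fst y)) b)"
    by (intro continuous_intros)
  then show ?thesis
    by (simp only: frechet_derivative_Basis_sum[OF assms, of _ "snd _", symmetric] case_prod_unfold)
qed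

text \<open>The Euler field and the rotation fields are all linear in the base point, so a field is
  encoded as a linear map \<open>L\<close>.\<close>

definition fieldderiv :: "('a \<Rightarrow> 'a) \<Rightarrow> ('a::euclidean_space \<Rightarrow> real) \<Rightarrow> 'a \<Rightarrow> real" where
  "fieldderiv L f z = frechet_derivative f (at z) (L z)"

lemma smooth_fieldderiv:
  assumes "smooth f" "linear L"
  shows "smooth (fieldderiv L f)"
proof -
  have "smooth (\<lambda>x. L x \<bullet> b)" for b
    unfolding smooth_def
    by (intro allI Ck_linear linear_compose[OF assms(2), unfolded o_def, of "\<lambda>y. y \<bullet> b"])
       (simp add: bounded_linear.linear bounded_linear_inner_left)
  then have "smooth (\<lambda>x. \<Sum>b\<in>Basis. (L x \<bullet> b) * frechet_derivative f (at x) b)"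
    by (intro smooth_sum smooth_mult smooth_partial assms)
  also have "(\<lambda>x. \<Sum>b\<in>Basis. (L x \<bullet> b) * frechet_derivative f (at x) b) = fieldderiv L f"
    by (rule ext) (simp only: fieldderiv_def frechet_derivative_Basis_sum[OF assms(1), of _ "L _", symmetric])
  finally show ?thesis .
qed

lemma smooth_directional:
  assumes "smooth f"
  shows "smooth (\<lambda>x. frechet_derivative f (at x) v)"
proof -
  have "smooth (\<lambda>x. \<Sum>b\<in>Basis. (v \<bullet> b) * frechet_derivative f (at x) b)"
    by (intro smooth_sum smooth_mult smooth_partial smooth_const assms)
  then show ?thesis
    by (simp only: frechet_derivative_Basis_sum[OF assms, of _ v, symmetric])
qed

lemma fieldderiv_add:
  "smooth f \<Longrightarrow> smooth g \<Longrightarrow> fieldderiv L (\<lambda>x. f x + g x) z = fieldderiv L f z + fieldderiv L g z"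
  unfolding fieldderiv_def
  by (rule fun_cong[OF frechet_derivative_at[symmetric]])
     (intro has_derivative_add smooth_has_derivative)

lemma fieldderiv_diff:
  "smooth f \<Longrightarrow> smooth g \<Longrightarrow> fieldderiv L (\<lambda>x. f x - g x) z = fieldderiv L f z - fieldderiv L g z"
  unfolding fieldderiv_def
  by (rule fun_cong[OF frechet_derivative_at[symmetric]])
     (intro has_derivative_diff smooth_has_derivative)

lemma fieldderiv_mult:
  "smooth f \<Longrightarrow> smooth g \<Longrightarrow>
    fieldderiv L (\<lambda>x. f x * g x) z = f z * fieldderiv L g z + fieldderiv L f z * g z"
  unfolding fieldderiv_def
  by (rule fun_cong[OF frechet_derivative_at[symmetric]])
     (intro has_derivative_mult smooth_has_derivative)

lemma fieldderiv_const: "fieldderiv L (\<lambda>_. c) z = 0"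
  by (simp add: fieldderiv_def)

lemma fieldderiv_power2:
  "smooth f \<Longrightarrow> fieldderiv L (\<lambda>x. (f x)\<^sup>2) z = 2 * f z * fieldderiv L f z"
  by (simp add: power2_eq_square fieldderiv_mult)

lemma smooth_line_derivative:
  assumes "smooth f"
  shows "((\<lambda>t. f (x + t *\<^sub>R v)) has_real_derivative frechet_derivative f (at (x + t *\<^sub>R v)) v) (at t within S)"
proof -
  have "((\<lambda>t. f (x + t *\<^sub>R v)) has_derivative (\<lambda>h. frechet_derivative f (at (x + t *\<^sub>R v)) (h *\<^sub>R v))) (at t within S)"
    by (rule has_derivative_compose[OF _ smooth_has_derivative[OF assms]])
       (auto intro!: derivative_eq_intros)
  moreover have "frechet_derivative f (at (x + t *\<^sub>R v)) (h *\<^sub>R v) = frechet_derivative f (at (x + t *\<^sub>R v)) v * h" for h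
    using has_derivative_linear[OF smooth_has_derivative[OF assms], of "x + t *\<^sub>R v"]
    by (simp add: linear_cmul)
  ultimately show ?thesis
    by (simp add: has_field_derivative_def)
qed

section \<open>Symmetry of second derivatives and iterated derivatives along linear fields\<close>

definition hess :: "('a::euclidean_space \<Rightarrow> real) \<Rightarrow> 'a \<Rightarrow> 'a \<Rightarrow> 'a \<Rightarrow> real" where
  "hess f z v w = frechet_derivative (\<lambda>x. frechet_derivative f (at x) w) (at z) v"

text \<open>The increment of the \<open>w\<close>-derivative of \<open>f\<close> along a segment in
  direction \<open>v\<close> is an integral of \<open>hess f _ w v\<close>. Its one-sided rate of
  change at the start of the segment is \<open>hess f z v w\<close> by definition and
  \<open>hess f z w v\<close> by continuity of the integrand.\<close>

lemma hess_commute: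
  assumes "smooth f"
  shows "hess f z v w = hess f z w v"
proof -
  define g where "g = (\<lambda>x. frechet_derivative f (at x) v)"
  have sg: "smooth g"
    unfolding g_def by (rule smooth_directional[OF assms])
  have A: "frechet_derivative f (at (z + s *\<^sub>R v)) w - frechet_derivative f (at z) w
      = integral {0..s} (\<lambda>r. hess f (z + r *\<^sub>R v) w v)" if "s \<ge> 0" for s
  proof -
    \<comment> \<open>One derivative in \<open>t\<close> is computed twice: here under the integral
      sign, and in \<open>3\<close> after the fundamental theorem of calculus has evaluated the
      \<open>r\<close>-integral.\<close>
    have 1: "((\<lambda>t. integral (cbox 0 s) (\<lambda>r. g (z + t *\<^sub>R w + r *\<^sub>R v))) has_real_derivative
       integral (cbox 0 s) (\<lambda>r. hess f (z + 0 *\<^sub>R w + r *\<^sub>R v) w v)) (at 0 within UNIV)"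
    proof (rule leibniz_rule_field_derivative)
      show "((\<lambda>t. g (z + t *\<^sub>R w + r *\<^sub>R v)) has_real_derivative
         hess f (z + t *\<^sub>R w + r *\<^sub>R v) w v) (at t within UNIV)" for t r
        using smooth_line_derivative[OF sg, of "z + r *\<^sub>R v" w t]
        by (simp add: hess_def g_def add_ac)
      show "(\<lambda>r. g (z + t *\<^sub>R w + r *\<^sub>R v)) integrable_on cbox 0 s" for t
        by (intro integrable_continuous continuous_on_compose2[OF smooth_continuous_on[OF sg, of UNIV]])
           (auto intro!: continuous_intros)
      show "continuous_on (UNIV \<times> cbox 0 s) (\<lambda>(t, r). hess f (z + t *\<^sub>R w + r *\<^sub>R v) w v)"
        unfolding hess_def split_beta
        by (rule continuous_on_compose2[OF smooth_continuous_on[OF smooth_directional[OF sg, unfolded g_def], of UNIV]])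
           (auto intro!: continuous_intros)
    qed auto
    have 2: "integral (cbox 0 s) (\<lambda>r. g (z + t *\<^sub>R w + r *\<^sub>R v)) = f (z + s *\<^sub>R v + t *\<^sub>R w) - f (z + t *\<^sub>R w)" for t
    proof -
      have "((\<lambda>r. g (z + t *\<^sub>R w + r *\<^sub>R v)) has_integral f (z + t *\<^sub>R w + s *\<^sub>R v) - f (z + t *\<^sub>R w + 0 *\<^sub>R v)) {0..s}"
        by (rule fundamental_theorem_of_calculus)
           (use that smooth_line_derivative[OF assms] in \<open>auto simp: g_def has_real_derivative_iff_has_vector_derivative[symmetric]\<close>)
      then show ?thesis by (simp add: integral_unique add_ac)
    qed
    have 3: "((\<lambda>t. f (z + s *\<^sub>R v + t *\<^sub>R w) - f (z + t *\<^sub>R w)) has_real_derivative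
        frechet_derivative f (at (z + s *\<^sub>R v)) w - frechet_derivative f (at z) w) (at 0)"
      using DERIV_diff[OF smooth_line_derivative[OF assms, of "z + s *\<^sub>R v" w 0 UNIV]
          smooth_line_derivative[OF assms, of z w 0 UNIV]] by simp
    show ?thesis
      using DERIV_unique[OF 1[unfolded 2] 3] by simp
  qed
  have c: "continuous_on {0..1} (\<lambda>r. hess f (z + r *\<^sub>R v) w v)"
    unfolding hess_def
    by (rule continuous_on_compose2[OF smooth_continuous_on[OF smooth_directional[OF sg, unfolded g_def], of UNIV]])
       (auto intro!: continuous_intros)
  have i: "((\<lambda>s. integral {0..s} (\<lambda>r. hess f (z + r *\<^sub>R v) w v)) has_real_derivative hess f (z + 0 *\<^sub>R v) w v)
     (at 0 within {0..1})"
    by (rule integral_has_real_derivative[OF c]) auto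
  have "((\<lambda>s. frechet_derivative f (at (z + s *\<^sub>R v)) w - frechet_derivative f (at z) w)
      has_real_derivative hess f z w v) (at 0 within {0..1})"
    using has_field_derivative_transform_within[OF i zero_less_one] by (simp add: A)
  moreover have "((\<lambda>s. frechet_derivative f (at (z + s *\<^sub>R v)) w - frechet_derivative f (at z) w)
      has_real_derivative hess f z v w) (at 0 within {0..1})"
    using DERIV_diff[OF smooth_line_derivative[OF smooth_directional[OF assms, of w], of z v 0 "{0..1}"] DERIV_const]
    by (simp add: hess_def)
  ultimately show ?thesis
    unfolding has_real_derivative_iff_has_vector_derivative
    by (intro vector_derivative_unique_within[of 0 "{0..1::real}"]) (simp add: at_within_Icc_at_right)
qed

lemma linear_frechet_derivative: "smooth f \<Longrightarrow> linear (frechet_derivative f (at z))"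
  using smooth_has_derivative has_derivative_linear by blast

lemma linear_hess_left: "smooth f \<Longrightarrow> linear (\<lambda>v. hess f z v w)"
  unfolding hess_def by (intro linear_frechet_derivative smooth_directional)

lemma linear_hess_right:
  assumes "smooth f"
  shows "linear (hess f z v)"
proof -
  have "hess f z v = (\<lambda>w. hess f z w v)"
    by (rule ext) (rule hess_commute[OF assms])
  then show ?thesis
    using linear_hess_left[OF assms] by simp
qed

text \<open>Product rule: the linear map \<open>K\<close> is its own derivative, which produces the
  first-order term. Since \<open>hess\<close> is symmetric, the commutator of two linear fields is
  the first derivative along \<open>K (L z) - L (K z)\<close>.\<close>

lemma fieldderiv_fieldderiv:
  assumes f: "smooth f" and K: "linear K"
  shows "fieldderiv L (fieldderiv K f) z
       = hess f z (L z) (K z) + frechet_derivative f (at z) (K (L z))"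
proof -
  have expand: "fieldderiv K f = (\<lambda>x. \<Sum>b\<in>Basis. (K x \<bullet> b) * frechet_derivative f (at x) b)"
    by (rule ext) (simp only: fieldderiv_def frechet_derivative_Basis_sum[OF f, of _ "K _", symmetric])
  have "(fieldderiv K f has_derivative
      (\<lambda>v. \<Sum>b\<in>Basis. (K z \<bullet> b) * hess f z v b + (K v \<bullet> b) * frechet_derivative f (at z) b)) (at z)"
    unfolding expand hess_def
    using K by (intro has_derivative_sum has_derivative_mult smooth_has_derivative smooth_directional f
        has_derivative_inner_left bounded_linear_imp_has_derivative) (simp add: linear_conv_bounded_linear)
  then have "fieldderiv L (fieldderiv K f) z
      = (\<Sum>b\<in>Basis. (K z \<bullet> b) * hess f z (L z) b + (K (L z) \<bullet> b) * frechet_derivative f (at z) b)"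
    by (simp add: fieldderiv_def[of L] frechet_derivative_at[symmetric])
  also have "\<dots> = (\<Sum>b\<in>Basis. (K z \<bullet> b) * hess f z (L z) b) + frechet_derivative f (at z) (K (L z))"
    by (simp add: sum.distrib frechet_derivative_Basis_sum[OF f, of _ "K (L z)", symmetric])
  also have "(\<Sum>b\<in>Basis. (K z \<bullet> b) * hess f z (L z) b) = hess f z (L z) (K z)"
    using Linear_Algebra.linear_componentwise[OF linear_hess_right[OF f], of z "L z" "K z" 1] by simp
  finally show ?thesis .
qed

section \<open>Integration over spheres\<close>

lemma sets_borel_ball [measurable]: "ball (x::'a::metric_space) r \<in> sets borel"
  by simp

lemma nn_integral_lborel_translate:
  fixes f :: "'a::euclidean_space \<Rightarrow> ennreal"
  assumes [measurable]: "f \<in> borel_measurable borel"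
  shows "(\<integral>\<^sup>+x. f (a + x) \<partial>lborel) = (\<integral>\<^sup>+x. f x \<partial>lborel)"
proof -
  have "(\<integral>\<^sup>+x. f x \<partial>lborel) = (\<integral>\<^sup>+x. f x \<partial>distr lborel borel ((+) a))"
    by (simp add: lborel_distr_plus)
  also have "\<dots> = (\<integral>\<^sup>+x. f (a + x) \<partial>lborel)"
    by (rule nn_integral_distr) auto
  finally show ?thesis ..
qed

lemma nn_integral_lborel_scale:
  fixes f :: "'a::euclidean_space \<Rightarrow> ennreal"
  assumes [measurable]: "f \<in> borel_measurable borel" and c: "0 < c"
  shows "(\<integral>\<^sup>+x. f x \<partial>lborel) = ennreal (c ^ DIM('a)) * (\<integral>\<^sup>+x. f (c *\<^sub>R x) \<partial>lborel)"
  by (subst lborel_affine[of c 0])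
     (use c in \<open>auto simp: nn_integral_density nn_integral_distr nn_integral_cmult\<close>)

text \<open>Double counting, based on translation invariance. Integrate
  \<open>indicator A (T y + x) * indicator B (T y)\<close> over \<open>x\<close> and
  \<open>y\<close>, where \<open>B\<close> is the unit ball. Integrating over \<open>x\<close> first
  gives the measure of \<open>A\<close> times that of \<open>B\<close>. If instead \<open>y\<close>
  is first shifted by a preimage of \<open>x\<close> under \<open>T\<close>, integration over
  \<open>x\<close> leaves the image measure of \<open>A\<close> times that of \<open>B\<close>. The
  measure of \<open>B\<close> is positive and finite, so it cancels.\<close>

lemma distr_lborel_orthogonal_transformation:
  fixes T :: "'a::euclidean_space \<Rightarrow> 'a"
  assumes T: "orthogonal_transformation T"
  shows "distr lborel borel T = lborel"
proof (rule measure_eqI)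
  fix A :: "'a set" assume "A \<in> sets (distr lborel borel T)"
  then have A[measurable]: "A \<in> sets borel" by simp
  have lin: "linear T" and nT: "norm (T x) = norm x" for x
    using T by (auto simp: orthogonal_transformation orthogonal_transformation_norm)
  have [measurable]: "T \<in> borel_measurable borel"
    using lin by (intro borel_measurable_continuous_onI linear_continuous_on) (simp add: linear_conv_bounded_linear)
  define B where "B = ball (0::'a) 1"
  have [measurable]: "B \<in> sets borel" by (simp add: B_def)
  have BT: "indicator B (T y) = (indicator B y :: ennreal)" for y
    by (simp add: B_def indicator_def nT)
  define b where "b = emeasure lborel B"
  have b: "b \<noteq> 0" "b \<noteq> top"
    using emeasure_lborel_ball_finite[of "0::'a" 1] unit_ball_vol_pos[OF of_nat_0_le_iff, of "DIM('a)", THEN less_imp_neq]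
    by (auto simp: b_def B_def emeasure_ball less_top[symmetric])
  have "emeasure lborel A * b = (\<integral>\<^sup>+y. indicator B y * emeasure lborel A \<partial>lborel)"
    by (simp add: nn_integral_multc b_def mult.commute)
  also have "\<dots> = (\<integral>\<^sup>+y. (\<integral>\<^sup>+x. indicator A (T y + x) * indicator B (T y) \<partial>lborel) \<partial>lborel)"
    by (simp add: nn_integral_cmult BT nn_integral_lborel_translate[of "indicator A"] mult.commute[of "indicator A _"])
  also have "\<dots> = (\<integral>\<^sup>+x. (\<integral>\<^sup>+y. indicator A (T y + x) * indicator B (T y) \<partial>lborel) \<partial>lborel)"
    by (rule lborel_pair.Fubini') measurable
  also have "\<dots> = (\<integral>\<^sup>+x. (\<integral>\<^sup>+y. indicator A (T y) * indicator (ball (T y) 1) x \<partial>lborel) \<partial>lborel)"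
  proof (rule nn_integral_cong)
    fix x :: 'a
    obtain a where a: "T a = x"
      using orthogonal_transformation_surj[OF T] by (metis surjD)
    have "(\<integral>\<^sup>+y. indicator A (T y + x) * indicator B (T y) \<partial>lborel)
        = (\<integral>\<^sup>+y. indicator A (T (a + y)) * indicator B (T (a + y) - x) \<partial>lborel)"
      using a lin by (simp add: linear_add add.commute)
    also have "\<dots> = (\<integral>\<^sup>+y. indicator A (T y) * indicator B (T y - x) \<partial>lborel)"
      by (rule nn_integral_lborel_translate[of "\<lambda>y. indicator A (T y) * indicator B (T y - x)"]) measurable
    also have "\<dots> = (\<integral>\<^sup>+y. indicator A (T y) * indicator (ball (T y) 1) x \<partial>lborel)"
      by (simp add: B_def dist_norm indicator_def norm_minus_commute)
    finally show "(\<integral>\<^sup>+y. indicator A (T y + x) * indicator B (T y) \<partial>lborel)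
        = (\<integral>\<^sup>+y. indicator A (T y) * indicator (ball (T y) 1) x \<partial>lborel)" .
  qed
  also have "\<dots> = (\<integral>\<^sup>+y. (\<integral>\<^sup>+x. indicator A (T y) * indicator (ball (T y) 1) x \<partial>lborel) \<partial>lborel)"
    by (rule lborel_pair.Fubini'[symmetric]) (simp add: indicator_def dist_norm)
  also have "\<dots> = (\<integral>\<^sup>+y. indicator A (T y) * b \<partial>lborel)"
    by (simp add: nn_integral_cmult emeasure_ball b_def B_def)
  also have "\<dots> = (\<integral>\<^sup>+y. indicator A (T y) \<partial>lborel) * b"
    by (simp add: nn_integral_multc)
  also have "(\<integral>\<^sup>+y. indicator A (T y) \<partial>lborel) = emeasure (distr lborel borel T) A"
    using nn_integral_distr[of T lborel borel "indicator A :: 'a \<Rightarrow> ennreal"] by simp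
  finally show "emeasure (distr lborel borel T) A = emeasure lborel A"
    using b ennreal_mult_cancel_left[of b] by (simp add: mult.commute[of _ b])
qed simp

text \<open>The image of Lebesgue measure on the unit ball under radial projection; up to the factor
  \<open>DIM('a)\<close> this is surface measure on the unit sphere.\<close>

definition cone_measure :: "'a::euclidean_space measure" where
  "cone_measure = distr (restrict_space lborel (ball 0 1)) borel sgn"

lemma borel_measurable_sgn_vector [measurable (raw)]:
  fixes f :: "'b \<Rightarrow> 'a::euclidean_space"
  assumes [measurable]: "f \<in> borel_measurable M"
  shows "(\<lambda>x. sgn (f x)) \<in> borel_measurable M"
  unfolding sgn_div_norm by measurable

lemma sets_cone_measure [measurable_cong, simp]: "sets cone_measure = sets borel"
  by (simp add: cone_measure_def)

lemma space_cone_measure [simp]: "space cone_measure = UNIV"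
  by (simp add: cone_measure_def)

lemma measurable_sgn_ball [measurable]:
  "(sgn :: 'a::euclidean_space \<Rightarrow> 'a) \<in> measurable (restrict_space lborel (ball 0 1)) borel"
  by (intro measurable_restrict_space1) measurable

lemma measure_cone_measure_UNIV:
  "measure (cone_measure :: 'a::euclidean_space measure) UNIV = measure lborel (ball (0::'a) 1)"
  by (simp add: cone_measure_def measure_distr space_restrict_space measure_restrict_space)

interpretation cone: finite_measure "cone_measure :: 'a::euclidean_space measure"
proof
  have "emeasure (cone_measure :: 'a measure) UNIV = emeasure lborel (ball (0::'a) 1)"
    by (simp add: cone_measure_def emeasure_distr space_restrict_space emeasure_restrict_space)
  then show "emeasure (cone_measure :: 'a measure) (space cone_measure) \<noteq> \<infinity>"
    using emeasure_lborel_ball_finite[of "0::'a" 1] by (simp add: less_top[symmetric])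
qed

lemma nn_integral_cone_measure:
  fixes f :: "'a::euclidean_space \<Rightarrow> ennreal"
  assumes [measurable]: "f \<in> borel_measurable borel"
  shows "(\<integral>\<^sup>+x. f x \<partial>cone_measure) = (\<integral>\<^sup>+z. f (sgn z) * indicator (ball 0 1) z \<partial>lborel)"
  by (simp add: cone_measure_def nn_integral_distr nn_integral_restrict_space)

lemma integral_cone_measure:
  fixes f :: "'a::euclidean_space \<Rightarrow> real"
  assumes [measurable]: "f \<in> borel_measurable borel"
  shows "(\<integral>x. f x \<partial>cone_measure) = (\<integral>z. indicator (ball 0 1) z * f (sgn z) \<partial>lborel)"
  by (simp add: cone_measure_def integral_distr integral_restrict_space)

text \<open>The origin is the one exception, since \<open>sgn 0 = 0\<close>; it is a null
  set.\<close>

lemma AE_cone_measure_norm: "AE x in (cone_measure :: 'a::euclidean_space measure). norm x = 1"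
proof -
  have "AE z in (lborel :: 'a measure). z \<noteq> 0"
    by (rule AE_lborel_singleton)
  then have "AE z in (lborel :: 'a measure). z \<in> ball 0 1 \<longrightarrow> norm (sgn z) = 1"
    by eventually_elim (simp add: norm_sgn)
  then show ?thesis
    unfolding cone_measure_def by (subst AE_distr_iff) (auto simp: AE_restrict_space_iff)
qed

lemma integrable_cone_measure:
  assumes "continuous_on UNIV f"
  shows "integrable cone_measure (f :: 'a::euclidean_space \<Rightarrow> real)"
proof -
  have "compact (f ` cball 0 1)"
    using assms by (intro compact_continuous_image) (auto intro: continuous_on_subset)
  then obtain C where C: "\<forall>x\<in>cball 0 1. norm (f x) \<le> C"
    using compact_imp_bounded[of "f ` cball 0 1"] by (auto simp: bounded_iff)
  have "AE x in cone_measure. norm (f x) \<le> C"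
    using AE_cone_measure_norm by eventually_elim (use C in \<open>simp add: Ball_def\<close>)
  then show ?thesis
    using borel_measurable_continuous_onI[OF assms]
    by (intro cone.integrable_const_bound[where B = C]) auto
qed

text \<open>\<open>T\<close> preserves the unit ball and commutes with \<open>sgn\<close>, so this
  reduces to the invariance of Lebesgue measure.\<close>

lemma integral_cone_measure_orthogonal:
  fixes f :: "'a::euclidean_space \<Rightarrow> real" and T :: "'a \<Rightarrow> 'a"
  assumes [measurable]: "f \<in> borel_measurable borel" and T: "orthogonal_transformation T"
  shows "(\<integral>x. f (T x) \<partial>cone_measure) = (\<integral>x. f x \<partial>cone_measure)"
proof -
  have lin: "linear T" and nT: "norm (T x) = norm x" for x
    using T by (auto simp: orthogonal_transformation orthogonal_transformation_norm)
  have [measurable]: "T \<in> borel_measurable borel"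
    using lin by (intro borel_measurable_continuous_onI linear_continuous_on) (simp add: linear_conv_bounded_linear)
  have s: "T (sgn z) = sgn (T z)" for z
    using lin by (simp add: sgn_div_norm nT linear_cmul)
  have "(\<integral>x. f (T x) \<partial>cone_measure) = (\<integral>z. indicator (ball 0 1) (T z) * f (sgn (T z)) \<partial>lborel)"
    by (simp add: integral_cone_measure s indicator_def nT)
  also have "\<dots> = (\<integral>z. indicator (ball 0 1) z * f (sgn z) \<partial>distr lborel borel T)"
    by (rule integral_distr[symmetric]) measurable
  finally show ?thesis
    by (simp add: distr_lborel_orthogonal_transformation[OF T] integral_cone_measure)
qed

text \<open>Dominated convergence for the difference quotients: by the mean value inequality they
  are bounded by the maximum of \<open>F'\<close> on the compact set \<open>?K\<close>, and
  constants are integrable for the finite measure.\<close>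

lemma has_real_derivative_integral_cone_measure:
  fixes F F' :: "real \<Rightarrow> 'a::euclidean_space \<Rightarrow> real"
  assumes F: "\<And>s. continuous_on UNIV (F s)"
    and F': "\<And>s x. ((\<lambda>s. F s x) has_real_derivative F' s x) (at s)"
    and cont: "continuous_on UNIV (\<lambda>(s, x). F' s x)"
  shows "((\<lambda>s. \<integral>x. F s x \<partial>cone_measure) has_real_derivative (\<integral>x. F' s x \<partial>cone_measure)) (at s)"
proof -
  let ?N = "cone_measure :: 'a measure"
  have [measurable]: "F s \<in> borel_measurable borel" for s
    by (rule borel_measurable_continuous_onI[OF F])
  have cF': "continuous_on UNIV (F' s)" for s
    using continuous_on_compose2[OF cont, of UNIV "\<lambda>x. (s, x)"]
    by (auto simp: continuous_on_Pair)
  have [measurable]: "F' s \<in> borel_measurable borel" for s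
    by (rule borel_measurable_continuous_onI[OF cF'])
  let ?K = "{s - 1..s + 1} \<times> cball (0::'a) 1"
  have "compact ((\<lambda>(s, x). F' s x) ` ?K)"
    by (intro compact_continuous_image compact_Times continuous_on_subset[OF cont]) auto
  then obtain C where C: "\<And>r x. r \<in> {s - 1..s + 1} \<Longrightarrow> norm x \<le> 1 \<Longrightarrow> \<bar>F' r x\<bar> \<le> C"
    using compact_imp_bounded[of "(\<lambda>(s, x). F' s x) ` ?K"] unfolding bounded_iff by fastforce
  have slope: "\<bar>(F y x - F s x) / (y - s)\<bar> \<le> C" if y: "y \<in> ball s 1" "y \<noteq> s" and x: "norm x \<le> 1" for y x
  proof -
    have "norm (F y x - F s x) \<le> C * norm (y - s)"
    proof (rule field_differentiable_bound[of "{s - 1..s + 1}" "\<lambda>s. F s x" "\<lambda>s. F' s x"])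
      show "((\<lambda>s. F s x) has_real_derivative F' r x) (at r within {s - 1..s + 1})" for r
        using F' by (rule has_field_derivative_at_within)
    qed (use y x C in \<open>auto simp: dist_real_def\<close>)
    then show ?thesis
      using y by (simp add: abs_divide field_simps)
  qed
  \<comment> \<open>Working within \<open>ball s 1\<close> keeps every sequence that tends to
    \<open>s\<close> in the range where \<open>slope\<close> applies.\<close>
  have "((\<lambda>y. ((\<integral>x. F y x \<partial>?N) - (\<integral>x. F s x \<partial>?N)) / (y - s)) \<longlongrightarrow> (\<integral>x. F' s x \<partial>?N)) (at s within ball s 1)"
    unfolding tendsto_at_iff_sequentially
  proof (intro allI impI)
    fix X assume X: "\<forall>i. X i \<in> ball s 1 - {s}" and lim: "X \<longlonglongrightarrow> s"
    have "(\<lambda>i. \<integral>x. (F (X i) x - F s x) / (X i - s) \<partial>?N) \<longlonglongrightarrow> (\<integral>x. F' s x \<partial>?N)"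
    proof (rule integral_dominated_convergence[where w = "\<lambda>_. C"])
      show "AE x in ?N. (\<lambda>i. (F (X i) x - F s x) / (X i - s)) \<longlonglongrightarrow> F' s x"
      proof (rule AE_I2)
        fix x :: 'a
        have "((\<lambda>y. (F y x - F s x) / (y - s)) \<longlongrightarrow> F' s x) (at s)"
          using F'[of x s] by (simp add: has_field_derivative_iff)
        then show "(\<lambda>i. (F (X i) x - F s x) / (X i - s)) \<longlonglongrightarrow> F' s x"
          using X lim unfolding tendsto_at_iff_sequentially o_def by auto
      qed
      show "AE x in ?N. norm ((F (X i) x - F s x) / (X i - s)) \<le> C" for i
        using AE_cone_measure_norm by eventually_elim (use slope X in auto)
    qed auto
    moreover have "(\<lambda>i. \<integral>x. (F (X i) x - F s x) / (X i - s) \<partial>?N)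
        = (\<lambda>i. ((\<integral>x. F (X i) x \<partial>?N) - (\<integral>x. F s x \<partial>?N)) / (X i - s))"
      by (simp add: integrable_cone_measure[OF F])
    ultimately show "((\<lambda>y. ((\<integral>x. F y x \<partial>?N) - (\<integral>x. F s x \<partial>?N)) / (y - s)) \<circ> X) \<longlonglongrightarrow> (\<integral>x. F' s x \<partial>?N)"
      by (simp only: o_def)
  qed
  then show ?thesis
    by (simp add: has_field_derivative_iff at_within_open[of s "ball s 1"])
qed

section \<open>Polar coordinates\<close>

lemma nn_integral_inverse_power_tail:
  assumes "0 < c" "0 < n"
  shows "(\<integral>\<^sup>+t. ennreal (real n / t ^ Suc n) * indicator {c<..} t \<partial>lborel) = ennreal (1 / c ^ n)"
proof -
  have "(\<integral>\<^sup>+t. ennreal (real n / t ^ Suc n) * indicator {c<..} t \<partial>lborel)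
      = (\<integral>\<^sup>+t. ennreal (real n / t ^ Suc n) * indicator {c..} t \<partial>lborel)"
    by (rule nn_integral_cong_AE, use AE_lborel_singleton[of c] in eventually_elim)
       (auto simp: indicator_def)
  also have "\<dots> = ennreal (0 - (- (1 / c ^ n)))"
  proof (rule nn_integral_FTC_atLeast)
    show "((\<lambda>t. - (1 / t ^ n)) has_real_derivative real n / t ^ Suc n) (at t)" if "c \<le> t" for t
    proof -
      have "t ^ n = t ^ (n - 1) * t" using \<open>0 < n\<close> by (simp add: power_eq_if mult.commute)
      then show ?thesis
        using that assms by (auto intro!: derivative_eq_intros simp: field_simps)
    qed
    show "((\<lambda>t::real. - (1 / t ^ n)) \<longlongrightarrow> 0) at_top"
    proof -
      have "filterlim (\<lambda>t::real. t ^ n) at_top at_top"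
        using assms by (intro filterlim_pow_at_top filterlim_ident)
      then have "((\<lambda>t::real. inverse (t ^ n)) \<longlongrightarrow> 0) at_top"
        by (intro tendsto_inverse_0_at_top)
      from tendsto_minus[OF this] show ?thesis by (simp add: inverse_eq_divide)
    qed
  qed (use assms in auto)
  finally show ?thesis by simp
qed

text \<open>Substituting \<open>t = \<bar>z\<bar>\<tau>\<close>, then \<open>w = \<tau>z\<close> and integrating out \<open>\<tau>\<close> reduces polar coordinates to
  Tonelli's theorem and the scaling behaviour of Lebesgue measure.\<close>

lemma nn_integral_polar:
  fixes h :: "'a::euclidean_space \<Rightarrow> ennreal"
  assumes [measurable]: "h \<in> borel_measurable borel"
  shows "(\<integral>\<^sup>+z. h z * indicator (ball 0 R) z \<partial>lborel)
       = (\<integral>\<^sup>+t. ennreal (DIM('a) * t ^ (DIM('a) - 1)) * (\<integral>\<^sup>+x. h (t *\<^sub>R x) \<partial>cone_measure)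
                * indicator {0<..<R} t \<partial>lborel)"
proof -
  define n where "n = DIM('a)"
  have n: "0 < n" by (simp add: n_def)
  have "(\<integral>\<^sup>+t. ennreal (n * t ^ (n - 1)) * (\<integral>\<^sup>+x. h (t *\<^sub>R x) \<partial>cone_measure) * indicator {0<..<R} t \<partial>lborel)
      = (\<integral>\<^sup>+t. (\<integral>\<^sup>+z. ennreal (n * t ^ (n - 1)) * h (t *\<^sub>R sgn z) * indicator (ball 0 1) z
            * indicator {0<..<R} t \<partial>lborel) \<partial>lborel)"
    by (rule nn_integral_cong, subst nn_integral_multc)
       (simp_all add: nn_integral_cone_measure nn_integral_cmult mult.assoc)
  also have "\<dots> = (\<integral>\<^sup>+z. (\<integral>\<^sup>+t. ennreal (n * t ^ (n - 1)) * h (t *\<^sub>R sgn z) * indicator (ball 0 1) z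
            * indicator {0<..<R} t \<partial>lborel) \<partial>(lborel :: 'a measure))"
    by (rule lborel_pair.Fubini'[symmetric]) simp
  \<comment> \<open>For \<open>z \<noteq> 0\<close> the variable \<open>t\<close> is replaced by
    \<open>norm z * t\<close>, which turns \<open>t *\<^sub>R sgn z\<close> into
    \<open>t *\<^sub>R z\<close>; the line element supplies the last of the \<open>n\<close> factors
    \<open>norm z\<close>.\<close>
  also have "\<dots> = (\<integral>\<^sup>+z. (\<integral>\<^sup>+t. ennreal (n * t ^ (n - 1) * norm z ^ n) * h (t *\<^sub>R z) * indicator (ball 0 1) z
            * indicator {0<..} t * indicator (ball 0 R) (t *\<^sub>R z) \<partial>lborel) \<partial>(lborel :: 'a measure))"
  proof (rule nn_integral_cong_AE, use AE_lborel_singleton[of "0::'a"] in eventually_elim)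
    fix z :: 'a assume z: "z \<noteq> 0"
    have "(\<integral>\<^sup>+t. ennreal (n * t ^ (n - 1)) * h (t *\<^sub>R sgn z) * indicator (ball 0 1) z
            * indicator {0<..<R} t \<partial>lborel)
       = ennreal (norm z) * (\<integral>\<^sup>+t. ennreal (n * (norm z * t) ^ (n - 1)) * h ((norm z * t) *\<^sub>R sgn z) * indicator (ball 0 1) z
            * indicator {0<..<R} (norm z * t) \<partial>lborel)"
      using nn_integral_real_affine[of "\<lambda>t. ennreal (n * t ^ (n - 1)) * h (t *\<^sub>R sgn z) * indicator (ball 0 1) z
            * indicator {0<..<R} t" "norm z" 0] z by simp
    also have "\<dots> = (\<integral>\<^sup>+t. ennreal (norm z) * (ennreal (n * (norm z * t) ^ (n - 1)) * h ((norm z * t) *\<^sub>R sgn z) * indicator (ball 0 1) z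
            * indicator {0<..<R} (norm z * t)) \<partial>lborel)"
      by (rule nn_integral_cmult[symmetric]) simp
    also have "\<dots> = (\<integral>\<^sup>+t. ennreal (n * t ^ (n - 1) * norm z ^ n) * h (t *\<^sub>R z) * indicator (ball 0 1) z
            * indicator {0<..} t * indicator (ball 0 R) (t *\<^sub>R z) \<partial>lborel)"
    proof (rule nn_integral_cong)
      fix t :: real
      have 1: "(norm z * t) *\<^sub>R sgn z = t *\<^sub>R z" using z by (simp add: sgn_div_norm)
      have 2: "indicator {0<..<R} (norm z * t) = (indicator {0<..} t * indicator (ball 0 R) (t *\<^sub>R z) :: ennreal)"
        using z by (auto simp: indicator_def zero_less_mult_iff mult.commute)
      have "norm z * (n * (norm z * t) ^ (n - 1)) = n * t ^ (n - 1) * norm z ^ n"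
        using n by (simp add: power_mult_distrib power_eq_if[of _ n])
      then have 3: "ennreal (norm z) * ennreal (n * (norm z * t) ^ (n - 1)) = ennreal (n * t ^ (n - 1) * norm z ^ n)"
        by (metis ennreal_mult' norm_ge_zero)
      show "ennreal (norm z) * (ennreal (n * (norm z * t) ^ (n - 1)) * h ((norm z * t) *\<^sub>R sgn z) * indicator (ball 0 1) z
            * indicator {0<..<R} (norm z * t))
         = ennreal (n * t ^ (n - 1) * norm z ^ n) * h (t *\<^sub>R z) * indicator (ball 0 1) z
            * indicator {0<..} t * indicator (ball 0 R) (t *\<^sub>R z)"
        unfolding 1 2 3[symmetric] by (simp add: mult_ac)
    qed
    finally show "(\<integral>\<^sup>+t. ennreal (n * t ^ (n - 1)) * h (t *\<^sub>R sgn z) * indicator (ball 0 1) z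
            * indicator {0<..<R} t \<partial>lborel)
       = (\<integral>\<^sup>+t. ennreal (n * t ^ (n - 1) * norm z ^ n) * h (t *\<^sub>R z) * indicator (ball 0 1) z
            * indicator {0<..} t * indicator (ball 0 R) (t *\<^sub>R z) \<partial>lborel)" .
  qed
  also have "\<dots> = (\<integral>\<^sup>+t. (\<integral>\<^sup>+z. ennreal (n * t ^ (n - 1) * norm z ^ n) * h (t *\<^sub>R z) * indicator (ball 0 1) z
            * indicator {0<..} t * indicator (ball 0 R) (t *\<^sub>R z) \<partial>(lborel :: 'a measure)) \<partial>lborel)"
    by (rule lborel_pair.Fubini') simp
  \<comment> \<open>With \<open>w = t *\<^sub>R z\<close>, membership of \<open>z\<close> in the
    unit ball becomes \<open>norm w < t\<close>. The power of \<open>t\<close> drops from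
    \<open>n - 1\<close> to \<open>- Suc n\<close>: once by \<open>n\<close> from
    \<open>norm z ^ n\<close> and once by \<open>n\<close> from the Jacobian.\<close>
  also have "\<dots> = (\<integral>\<^sup>+t. (\<integral>\<^sup>+w. h w * indicator (ball 0 R) w * ennreal (norm w ^ n)
            * (ennreal (n / t ^ Suc n) * indicator {norm w<..} t) \<partial>(lborel :: 'a measure)) \<partial>lborel)"
  proof (rule nn_integral_cong)
    fix t :: real
    show "(\<integral>\<^sup>+z. ennreal (n * t ^ (n - 1) * norm z ^ n) * h (t *\<^sub>R z) * indicator (ball 0 1) z
            * indicator {0<..} t * indicator (ball 0 R) (t *\<^sub>R z) \<partial>(lborel :: 'a measure))
        = (\<integral>\<^sup>+w. h w * indicator (ball 0 R) w * ennreal (norm w ^ n)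
            * (ennreal (n / t ^ Suc n) * indicator {norm w<..} t) \<partial>(lborel :: 'a measure))" (is "?l = ?r")
    proof (cases "0 < t")
      case False
      then have "indicator {norm w<..} t = (0::ennreal)" for w :: 'a
        using norm_ge_zero[of w] by (auto simp: indicator_def simp del: norm_ge_zero)
      with False show ?thesis by simp
    next
      case t: True
      have "?r = ennreal (t ^ n) * (\<integral>\<^sup>+w. h (t *\<^sub>R w) * indicator (ball 0 R) (t *\<^sub>R w) * ennreal (norm (t *\<^sub>R w) ^ n)
            * (ennreal (n / t ^ Suc n) * indicator {norm (t *\<^sub>R w)<..} t) \<partial>(lborel :: 'a measure))"
        unfolding n_def by (rule nn_integral_lborel_scale[OF _ t]) (simp add: indicator_def)
      also have "\<dots> = (\<integral>\<^sup>+w. ennreal (t ^ n) * (h (t *\<^sub>R w) * indicator (ball 0 R) (t *\<^sub>R w) * ennreal (norm (t *\<^sub>R w) ^ n)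
            * (ennreal (n / t ^ Suc n) * indicator {norm (t *\<^sub>R w)<..} t)) \<partial>(lborel :: 'a measure))"
        by (rule nn_integral_cmult[symmetric]) (simp add: indicator_def)
      also have "\<dots> = ?l"
      proof (rule nn_integral_cong)
        fix w :: 'a
        have 1: "indicator {norm (t *\<^sub>R w)<..} t = (indicator (ball 0 1) w :: ennreal)"
          using t by (auto simp: indicator_def)
        have "t ^ n * (norm (t *\<^sub>R w) ^ n * (n / t ^ Suc n)) = n * t ^ (n - 1) * norm w ^ n"
          using t n by (simp add: power_mult_distrib power_eq_if[of _ n] field_simps)
        then have 2: "ennreal (t ^ n) * (ennreal (norm (t *\<^sub>R w) ^ n) * ennreal (n / t ^ Suc n))
            = ennreal (n * t ^ (n - 1) * norm w ^ n)"
          using t by (simp add: ennreal_mult'[symmetric] del: power_Suc)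
        show "ennreal (t ^ n) * (h (t *\<^sub>R w) * indicator (ball 0 R) (t *\<^sub>R w) * ennreal (norm (t *\<^sub>R w) ^ n)
            * (ennreal (n / t ^ Suc n) * indicator {norm (t *\<^sub>R w)<..} t))
          = ennreal (n * t ^ (n - 1) * norm w ^ n) * h (t *\<^sub>R w) * indicator (ball 0 1) w
            * indicator {0<..} t * indicator (ball 0 R) (t *\<^sub>R w)"
          unfolding 1 2[symmetric] using t by (simp add: mult_ac)
      qed
      finally show ?thesis ..
    qed
  qed
  also have "\<dots> = (\<integral>\<^sup>+w. (\<integral>\<^sup>+t. h w * indicator (ball 0 R) w * ennreal (norm w ^ n)
            * (ennreal (n / t ^ Suc n) * indicator {norm w<..} t) \<partial>lborel) \<partial>(lborel :: 'a measure))"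
    by (rule lborel_pair.Fubini'[symmetric]) (simp add: indicator_def)
  \<comment> \<open>The \<open>t\<close>-integral over \<open>norm w < t\<close> is
    \<open>1 / norm w ^ n\<close>, which cancels the factor \<open>norm w ^ n\<close>; the null
    point \<open>w = 0\<close> is left out.\<close>
  also have "\<dots> = (\<integral>\<^sup>+w. h w * indicator (ball 0 R) w \<partial>lborel)"
  proof (rule nn_integral_cong_AE, use AE_lborel_singleton[of "0::'a"] in eventually_elim)
    fix w :: 'a assume w: "w \<noteq> 0"
    have "(\<integral>\<^sup>+t. h w * indicator (ball 0 R) w * ennreal (norm w ^ n)
            * (ennreal (n / t ^ Suc n) * indicator {norm w<..} t) \<partial>lborel)
       = h w * indicator (ball 0 R) w * (ennreal (norm w ^ n) * ennreal (1 / norm w ^ n))"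
      using w n by (simp add: nn_integral_cmult nn_integral_inverse_power_tail mult.assoc del: power_Suc)
    also have "ennreal (norm w ^ n) * ennreal (1 / norm w ^ n) = 1"
      using w by (simp add: ennreal_mult'[symmetric])
    finally show "(\<integral>\<^sup>+t. h w * indicator (ball 0 R) w * ennreal (norm w ^ n)
            * (ennreal (n / t ^ Suc n) * indicator {norm w<..} t) \<partial>lborel) = h w * indicator (ball 0 R) w"
      by simp
  qed
  finally show ?thesis
    by (simp add: n_def)
qed

section \<open>Integrals over spheres as functions of the radius\<close>

definition sphere_int :: "real \<Rightarrow> ('a::euclidean_space \<Rightarrow> real) \<Rightarrow> real" where
  "sphere_int t g = (\<integral>x. g (t *\<^sub>R x) \<partial>cone_measure)"

lemma integrable_sphere_int:
  "smooth g \<Longrightarrow> integrable cone_measure (\<lambda>x. g (t *\<^sub>R x))"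
  by (intro integrable_cone_measure continuous_on_compose2[OF smooth_continuous_on[of g UNIV]])
     (auto intro!: continuous_intros)

lemma sphere_int_add:
  "smooth f \<Longrightarrow> smooth g \<Longrightarrow> sphere_int t (\<lambda>z. f z + g z) = sphere_int t f + sphere_int t g"
  by (simp add: sphere_int_def integrable_sphere_int)

lemma sphere_int_diff:
  "smooth f \<Longrightarrow> smooth g \<Longrightarrow> sphere_int t (\<lambda>z. f z - g z) = sphere_int t f - sphere_int t g"
  by (simp add: sphere_int_def integrable_sphere_int)

lemma sphere_int_cmult: "sphere_int t (\<lambda>z. c * f z) = c * sphere_int t f"
  by (simp add: sphere_int_def)

text \<open>The total mass is the volume of the unit ball at every radius, so the degenerate sphere
  \<open>t = 0\<close> still sees the value at the centre; boundary terms at radius 0 are read off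
  from this.\<close>

lemma sphere_int_zero: "sphere_int 0 (g :: 'a::euclidean_space \<Rightarrow> real) = measure lborel (ball (0::'a) 1) * g 0"
  by (simp add: sphere_int_def measure_cone_measure_UNIV)

lemma sphere_int_mono:
  fixes f g :: "'a::euclidean_space \<Rightarrow> real"
  assumes "smooth f" "smooth g" "\<And>z. norm z = \<bar>t\<bar> \<Longrightarrow> f z \<le> g z"
  shows "sphere_int t f \<le> sphere_int t g"
  unfolding sphere_int_def
proof (rule integral_mono_AE)
  show "AE x in cone_measure. f (t *\<^sub>R x) \<le> g (t *\<^sub>R x)"
    using AE_cone_measure_norm by eventually_elim (simp add: assms(3))
qed (intro integrable_sphere_int assms)+

text \<open>Differentiating along rays covers \<open>t = 0\<close> as well and so gives continuity
  on intervals that start at the centre; the form with the Euler field divides by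
  \<open>t\<close>.\<close>

lemma sphere_int_has_real_derivative_aux:
  fixes g :: "'a::euclidean_space \<Rightarrow> real"
  assumes "smooth g"
  shows "((\<lambda>t. sphere_int t g) has_real_derivative
      (\<integral>x. frechet_derivative g (at (t *\<^sub>R x)) x \<partial>cone_measure)) (at t)"
  unfolding sphere_int_def
proof (rule has_real_derivative_integral_cone_measure)
  show "continuous_on UNIV (\<lambda>x. g (s *\<^sub>R x))" for s
    by (rule continuous_on_compose2[OF smooth_continuous_on[OF assms, of UNIV]]) (auto intro!: continuous_intros)
  show "((\<lambda>s. g (s *\<^sub>R x)) has_real_derivative frechet_derivative g (at (s *\<^sub>R x)) x) (at s)" for s x
    using smooth_line_derivative[OF assms, of 0 x s UNIV] by simp
  show "continuous_on UNIV (\<lambda>(s, x). frechet_derivative g (at (s *\<^sub>R x)) x)"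
  proof -
    have "continuous_on UNIV (\<lambda>y :: real \<times> 'a. (fst y *\<^sub>R snd y, snd y))"
      by (intro continuous_intros)
    from continuous_on_compose2[OF continuous_frechet_derivative[OF assms] this] show ?thesis
      by (simp add: case_prod_unfold)
  qed
qed

lemma continuous_on_sphere_int: "smooth g \<Longrightarrow> continuous_on S (\<lambda>t. sphere_int t g)"
  by (intro continuous_at_imp_continuous_on ballI DERIV_isCont[OF sphere_int_has_real_derivative_aux])

lemma sphere_int_has_real_derivative:
  assumes g: "smooth g" and t: "t \<noteq> 0"
  shows "((\<lambda>t. sphere_int t g) has_real_derivative sphere_int t (fieldderiv (\<lambda>z. z) g) / t) (at t)"
proof -
  have "fieldderiv (\<lambda>z. z) g (t *\<^sub>R x) / t = frechet_derivative g (at (t *\<^sub>R x)) x" for x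
    using t by (simp add: fieldderiv_def linear_cmul[OF linear_frechet_derivative[OF g]])
  then have "sphere_int t (fieldderiv (\<lambda>z. z) g) / t = (\<integral>x. frechet_derivative g (at (t *\<^sub>R x)) x \<partial>cone_measure)"
    unfolding sphere_int_def by (subst integral_divide_zero[symmetric]) simp
  then show ?thesis
    using sphere_int_has_real_derivative_aux[OF g] by simp
qed

text \<open>The integral of \<open>g\<close> over a sphere does not change along the rotations
  \<open>cos s + sin s L\<close>; differentiate at \<open>s = 0\<close>.\<close>

lemma sphere_int_fieldderiv_rotation:
  fixes L :: "'a::euclidean_space \<Rightarrow> 'a"
  assumes g: "smooth g" and L: "linear L" "\<And>z. norm (L z) = norm z" "\<And>z. z \<bullet> L z = 0"
  shows "sphere_int t (fieldderiv L g) = 0"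
proof -
  define rot where "rot s x = cos s *\<^sub>R x + sin s *\<^sub>R L x" for s x
  define rot' where "rot' s x = cos s *\<^sub>R L x - sin s *\<^sub>R x" for s x
  have cL: "continuous_on UNIV L"
    using L(1) by (simp add: linear_continuous_on linear_conv_bounded_linear)
  have cL2: "continuous_on UNIV (\<lambda>y :: real \<times> 'a. L (snd y))"
    by (rule continuous_on_compose2[OF cL]) (auto intro!: continuous_intros)
  \<comment> \<open>\<open>L x\<close> is orthogonal to \<open>x\<close> and of the same length, so
    Pythagoras shows that \<open>rot s\<close> preserves norms.\<close>
  have ort: "orthogonal_transformation (rot s)" for s
  proof -
    have "linear (rot s)"
      unfolding rot_def using L(1) by (intro linear_compose_add linear_compose_scale_right) (auto simp: linear_id[unfolded id_def])
    moreover have "norm (rot s x) = norm x" for x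
    proof (rule power2_eq_imp_eq)
      have "(norm (rot s x))\<^sup>2 = (cos s)\<^sup>2 * (norm x)\<^sup>2 + (sin s)\<^sup>2 * (norm x)\<^sup>2"
        unfolding rot_def using L(3)[of x]
        by (simp add: power2_norm_eq_inner[symmetric] L(2) power_mult_distrib norm_add_Pythagorean orthogonal_def)
      then show "(norm (rot s x))\<^sup>2 = (norm x)\<^sup>2"
        by (simp add: distrib_right[symmetric])
    qed simp_all
    ultimately show ?thesis by (simp add: orthogonal_transformation)
  qed
  have der: "((\<lambda>s. \<integral>x. g (t *\<^sub>R rot s x) \<partial>cone_measure) has_real_derivative
      (\<integral>x. frechet_derivative g (at (t *\<^sub>R rot 0 x)) (t *\<^sub>R rot' 0 x) \<partial>cone_measure)) (at 0)"
  proof (rule has_real_derivative_integral_cone_measure)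
    show "continuous_on UNIV (\<lambda>x. g (t *\<^sub>R rot s x))" for s
      unfolding rot_def
      by (rule continuous_on_compose2[OF smooth_continuous_on[OF g, of UNIV]]) (auto intro!: continuous_intros cL)
    show "((\<lambda>s. g (t *\<^sub>R rot s x)) has_real_derivative
        frechet_derivative g (at (t *\<^sub>R rot s x)) (t *\<^sub>R rot' s x)) (at s)" for s x
    proof -
      have "((\<lambda>s. t *\<^sub>R rot s x) has_derivative (\<lambda>h. h *\<^sub>R (t *\<^sub>R rot' s x))) (at s)"
        unfolding rot_def rot'_def
        by (auto intro!: derivative_eq_intros simp: algebra_simps)
      from has_derivative_compose[OF this smooth_has_derivative[OF g]]
      have "((\<lambda>s. g (t *\<^sub>R rot s x)) has_derivative
          (\<lambda>h. frechet_derivative g (at (t *\<^sub>R rot s x)) (h *\<^sub>R (t *\<^sub>R rot' s x)))) (at s)" .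
      then show ?thesis
        unfolding has_field_derivative_def linear_cmul[OF linear_frechet_derivative[OF g]] real_scaleR_def
        by (simp only: mult.commute[of _ "t * _"])
    qed
    show "continuous_on UNIV (\<lambda>(s, x). frechet_derivative g (at (t *\<^sub>R rot s x)) (t *\<^sub>R rot' s x))"
    proof -
      have "continuous_on UNIV (\<lambda>y. (t *\<^sub>R rot (fst y) (snd y), t *\<^sub>R rot' (fst y) (snd y)))"
        unfolding rot_def rot'_def by (intro continuous_intros cL2)
      from continuous_on_compose2[OF continuous_frechet_derivative[OF g] this] show ?thesis
        by (simp add: case_prod_unfold)
    qed
  qed
  have inv: "(\<integral>x. g (t *\<^sub>R rot s x) \<partial>cone_measure) = sphere_int t g" for s
  proof -
    have "(\<lambda>x. g (t *\<^sub>R x)) \<in> borel_measurable borel"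
      by (intro borel_measurable_continuous_onI continuous_on_compose2[OF smooth_continuous_on[OF g, of UNIV]])
         (auto intro!: continuous_intros)
    from integral_cone_measure_orthogonal[OF this ort] show ?thesis
      by (simp add: sphere_int_def)
  qed
  have "(\<integral>x. frechet_derivative g (at (t *\<^sub>R rot 0 x)) (t *\<^sub>R rot' 0 x) \<partial>cone_measure) = 0"
    using der unfolding inv by (rule DERIV_unique[OF _ DERIV_const])
  moreover have "frechet_derivative g (at (t *\<^sub>R rot 0 x)) (t *\<^sub>R rot' 0 x) = fieldderiv L g (t *\<^sub>R x)" for x
    using L(1) by (simp add: rot_def rot'_def fieldderiv_def linear_cmul)
  ultimately show ?thesis
    by (simp add: sphere_int_def)
qed

section \<open>Surface measure, sphere averages and the essential supremum\<close>

lemma integral_lborel_scale: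
  fixes f :: "'a::euclidean_space \<Rightarrow> real"
  assumes [measurable]: "f \<in> borel_measurable borel" and c: "0 < c"
  shows "(\<integral>x. f x \<partial>lborel) = c ^ DIM('a) * (\<integral>x. f (c *\<^sub>R x) \<partial>lborel)"
  by (subst lborel_affine[of c 0])
     (use c in \<open>auto simp: integral_density integral_distr\<close>)

lemma measure_lborel_ball:
  assumes "0 < R"
  shows "measure lborel (ball (0::'a::euclidean_space) R) = R ^ DIM('a) * measure lborel (ball (0::'a) 1)"
proof -
  have "measure lborel (ball (0::'a) R) = (\<integral>x. indicator (ball (0::'a) R) x \<partial>lborel)"
    by simp
  also have "\<dots> = R ^ DIM('a) * (\<integral>x. indicator (ball (0::'a) R) (R *\<^sub>R x) \<partial>lborel)"
    by (rule integral_lborel_scale[OF _ assms]) simp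
  also have "(\<lambda>x::'a. indicator (ball (0::'a) R) (R *\<^sub>R x)) = (indicator (ball 0 1) :: 'a \<Rightarrow> real)"
    using assms by (auto simp: indicator_def fun_eq_iff)
  finally show ?thesis by simp
qed

lemma integral_scale_measure:
  fixes f :: "'a \<Rightarrow> real"
  assumes [measurable]: "f \<in> borel_measurable M" and "0 \<le> c"
  shows "(\<integral>x. f x \<partial>scale_measure (ennreal c) M) = c * (\<integral>x. f x \<partial>M)"
proof -
  have "scale_measure (ennreal c) M = density M (\<lambda>_. ennreal c)"
    by (rule measure_eqI) (simp_all add: emeasure_density nn_integral_cmult_indicator)
  then show ?thesis
    using assms(2) by (simp add: integral_density)
qed

text \<open>The factor \<open>DIM('a) / R\<close> is the one in \<open>surface_measure\<close>;
  rescaling the ball of radius \<open>R\<close> to the unit ball contributes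
  \<open>R ^ DIM('a)\<close>.\<close>

lemma integral_surface_measure:
  fixes g :: "'a::euclidean_space \<Rightarrow> real" and R :: real
  assumes R: "0 < R" and g: "continuous_on UNIV g"
  shows "(\<integral>z. g z \<partial>surface_measure R) = DIM('a) * R ^ DIM('a) / R * sphere_int R g"
proof -
  have [measurable]: "g \<in> borel_measurable borel"
    by (rule borel_measurable_continuous_onI[OF g])
  have m1: "(\<lambda>z::'a. R *\<^sub>R sgn z) \<in> measurable (restrict_space lborel (ball 0 R - {0})) (restrict_space borel (sphere 0 R))"
    using R by (intro measurable_restrict_space2 measurable_restrict_space1)
      (auto simp: space_restrict_space norm_sgn)
  have "(\<integral>z. g z \<partial>surface_measure R) = DIM('a) / R * (\<integral>z. g z \<partial>distr (restrict_space lborel (ball 0 R - {0})) (restrict_space borel (sphere 0 R))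
            (\<lambda>z. R *\<^sub>R sgn z))"
    unfolding surface_measure_def using R by (subst integral_scale_measure) (auto intro!: measurable_restrict_space1)
  also have "(\<integral>z. g z \<partial>distr (restrict_space lborel (ball 0 R - {0})) (restrict_space borel (sphere 0 R))
            (\<lambda>z. R *\<^sub>R sgn z)) = (\<integral>z. g (R *\<^sub>R sgn z) \<partial>restrict_space lborel (ball 0 R - {0}))"
    by (rule integral_distr[OF m1]) (intro measurable_restrict_space1, simp)
  also have "\<dots> = (\<integral>z. indicator (ball 0 R - {0}) z * g (R *\<^sub>R sgn z) \<partial>lborel)"
    by (subst integral_restrict_space) auto
  also have "\<dots> = (\<integral>z. indicator (ball 0 R) z * g (R *\<^sub>R sgn z) \<partial>lborel)"
    by (rule integral_cong_AE) (auto intro: eventually_mono[OF AE_lborel_singleton[of 0]] simp: indicator_def)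
  also have "\<dots> = R ^ DIM('a) * (\<integral>z. indicator (ball 0 R) (R *\<^sub>R z) * g (R *\<^sub>R sgn (R *\<^sub>R z)) \<partial>lborel)"
    by (rule integral_lborel_scale[OF _ R]) simp
  also have "(\<integral>z. indicator (ball 0 R) (R *\<^sub>R z) * g (R *\<^sub>R sgn (R *\<^sub>R z)) \<partial>lborel)
      = (\<integral>z. indicator (ball 0 1) z * g (R *\<^sub>R sgn z) \<partial>lborel)"
    using R by (intro Bochner_Integration.integral_cong) (auto simp: indicator_def sgn_scaleR)
  also have "\<dots> = sphere_int R g"
    by (simp add: sphere_int_def integral_cone_measure)
  finally show ?thesis by simp
qed

text \<open>The sphere is the whole space of \<open>surface_measure R\<close>, so agreement there
  suffices. This allows \<open>radial_deriv u\<close> to be replaced by a smooth function.\<close>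

lemma sphere_average_eq:
  fixes f g :: "'a::euclidean_space \<Rightarrow> real" and R :: real
  assumes R: "0 < R" and g: "continuous_on UNIV g" and fg: "\<And>z. norm z = R \<Longrightarrow> f z = g z"
  shows "sphere_average R f = sphere_int R g / measure lborel (ball (0::'a) 1)"
proof -
  have sp: "space (surface_measure R :: 'a measure) = sphere 0 R"
    by (simp add: surface_measure_def space_scale_measure space_restrict_space)
  have "measure (surface_measure R) (sphere (0::'a) R) = (\<integral>z. 1 \<partial>(surface_measure R :: 'a measure))"
    using sp by simp
  also have "\<dots> = DIM('a) * R ^ DIM('a) / R * sphere_int R (\<lambda>_::'a. 1)"
    by (rule integral_surface_measure[OF R continuous_on_const])
  also have "sphere_int R (\<lambda>_::'a. 1) = measure lborel (ball (0::'a) 1)"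
    by (simp add: sphere_int_def measure_cone_measure_UNIV)
  finally have m: "measure (surface_measure R) (sphere (0::'a) R) = DIM('a) * R ^ DIM('a) / R * measure lborel (ball (0::'a) 1)" .
  have "(\<integral>z. f z \<partial>surface_measure R) = (\<integral>z. g z \<partial>surface_measure R)"
    by (rule Bochner_Integration.integral_cong) (auto simp: sp fg)
  then show ?thesis
    using R by (simp add: sphere_average_def m integral_surface_measure[OF R g])
qed

text \<open>Within the open ball, the set where a continuous function exceeds its essential bound is
  open and negligible, hence empty; the boundary sphere follows by closure.\<close>

lemma abs_le_Linf_norm:
  fixes f :: "'a::euclidean_space \<Rightarrow> real"
  assumes f: "continuous_on UNIV f" and R: "0 < R" and z: "norm z \<le> R"
  shows "\<bar>f z\<bar> \<le> Linf_norm (cball 0 R) f"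
proof -
  let ?M = "lebesgue_on (cball (0::'a) R)"
  define e where "e = esssup ?M (\<lambda>z. ereal \<bar>f z\<bar>)"
  have meas: "(\<lambda>z. ereal \<bar>f z\<bar>) \<in> borel_measurable ?M"
    using borel_measurable_continuous_onI[OF f] by (intro measurable_restrict_space1 measurable_completion) auto
  have ae: "AE x in ?M. ereal \<bar>f x\<bar> \<le> e"
    unfolding e_def by (rule esssup_AE)
  have "compact (f ` cball 0 R)"
    using f by (intro compact_continuous_image) (auto intro: continuous_on_subset)
  then obtain C where C: "\<forall>x\<in>cball 0 R. norm (f x) \<le> C"
    using compact_imp_bounded[of "f ` cball 0 R"] by (auto simp: bounded_iff)
  have "e \<le> ereal C"
    unfolding e_def using C by (intro esssup_I[OF meas] AE_I2) (auto simp: space_restrict_space)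
  have key: "\<bar>f z\<bar> \<le> c" if c: "e \<le> ereal c" for c
  proof -
    have "AE x in lebesgue. x \<in> cball 0 R \<longrightarrow> \<bar>f x\<bar> \<le> c"
      using ae c by (auto simp: AE_restrict_space_iff elim!: eventually_mono dest: order_trans)
    then obtain N where N: "N \<in> null_sets lebesgue" "{x. \<not> (x \<in> cball 0 R \<longrightarrow> \<bar>f x\<bar> \<le> c)} \<subseteq> N"
      by (auto simp: eventually_ae_filter)
    let ?U = "ball 0 R \<inter> {x. c < \<bar>f x\<bar>}"
    have "open ?U"
      using f by (intro open_Int open_ball open_Collect_less continuous_intros)
    moreover have "?U \<subseteq> N" using N(2) by auto
    then have "negligible ?U"
      using N(1) negligible_subset negligible_iff_null_sets by blast
    ultimately have "?U = {}"
      using open_not_negligible by blast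
    then have "\<bar>f x\<bar> \<le> c" if "x \<in> ball 0 R" for x using that by force
    moreover have "z \<in> closure (ball 0 R)" using R z by simp
    ultimately show ?thesis
      using continuous_le_on_closure[of "ball 0 R" "\<lambda>x. \<bar>f x\<bar>" z c] f
      by (auto intro: continuous_on_subset continuous_intros)
  qed
  \<comment> \<open>\<open>real_of_ereal\<close> sends infinite values to 0, so \<open>e\<close> has
    to be finite: \<open>C\<close> bounds it from above, and the value minus infinity would give
    \<open>\<bar>f z\<bar> \<le> -1\<close>.\<close>
  have "e \<noteq> - \<infinity>"
    using key[of "-1"] abs_ge_zero[of "f z"] by (cases e) auto
  with \<open>e \<le> ereal C\<close> obtain m where m: "e = ereal m"
    by (cases e) auto
  with key[of m] show ?thesis
    by (simp add: Linf_norm_def e_def[symmetric])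
qed

section \<open>The Levi form on the quaternionic frame\<close>

text \<open>Multiplication by the quaternion units; \<open>cI\<close> is the complex structure, and at \<open>z = axis 1 1\<close>
  the frame \<open>z, cI z, cX z, cY z\<close> is the oriented standard basis.\<close>

definition cI :: "C2 \<Rightarrow> C2" where "cI z = (\<chi> k. \<i> * z $ k)"

definition cX :: "C2 \<Rightarrow> C2" where "cX z = (\<chi> k. if k = 1 then - cnj (z $ 2) else cnj (z $ 1))"

definition cY :: "C2 \<Rightarrow> C2" where "cY z = cI (cX z)"

lemma C2_nth [simp]:
  "cI z $ k = \<i> * z $ k" "cX z $ 1 = - cnj (z $ 2)" "cX z $ 2 = cnj (z $ 1)"
  "cY z $ 1 = - \<i> * cnj (z $ 2)" "cY z $ 2 = \<i> * cnj (z $ 1)"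
  by (simp_all add: cI_def cX_def cY_def)

lemma linear_cI: "linear cI" and linear_cX: "linear cX" and linear_cY: "linear cY"
  by (intro linearI; simp add: vec_eq_iff forall_2 algebra_simps)+

lemma quaternion_relations:
  "cI (cI z) = - z" "cI (cX z) = cY z" "cI (cY z) = - cX z" "cX (cI z) = - cY z" "cX (cX z) = - z"
  "cX (cY z) = cI z" "cY (cI z) = cX z" "cY (cX z) = - cI z" "cY (cY z) = - z"
  by (simp_all add: vec_eq_iff forall_2 complex_eq_iff)

lemma norm_C2: "(norm (z :: C2))\<^sup>2 = (Re (z $ 1))\<^sup>2 + (Im (z $ 1))\<^sup>2 + (Re (z $ 2))\<^sup>2 + (Im (z $ 2))\<^sup>2"
  by (simp add: norm_vec_def L2_set_def sum_2 cmod_power2)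

lemma norm_rotations: "norm (cI z) = norm z" "norm (cX z) = norm z" "norm (cY z) = norm z"
  by (rule power2_eq_imp_eq; simp add: norm_C2)+

lemma inner_rotations: "z \<bullet> cI z = 0" "z \<bullet> cX z = 0" "z \<bullet> cY z = 0"
  by (simp_all add: inner_vec_def sum_2 inner_complex_def)

lemma C2_decompose:
  "(v :: C2) = Re (v $ 1) *\<^sub>R axis 1 1 + Im (v $ 1) *\<^sub>R axis 1 \<i> + Re (v $ 2) *\<^sub>R axis 2 1 + Im (v $ 2) *\<^sub>R axis 2 \<i>"
  by (simp add: vec_eq_iff forall_2 axis_def complex_eq_iff)

lemma linear_C2_expand:
  assumes "linear (f :: C2 \<Rightarrow> real)"
  shows "f v = Re (v $ 1) * f (axis 1 1) + Im (v $ 1) * f (axis 1 \<i>)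
             + Re (v $ 2) * f (axis 2 1) + Im (v $ 2) * f (axis 2 \<i>)"
  by (subst C2_decompose[of v]) (simp only: linear_add[OF assms] linear_cmul[OF assms] real_scaleR_def)

lemma cI_axis: "cI (axis k c) = axis k (\<i> * c)"
  by (simp add: vec_eq_iff axis_def)

lemma frechet_derivative_of_real:
  assumes "smooth u"
  shows "frechet_derivative (\<lambda>w. complex_of_real (u w)) (at z) v = complex_of_real (frechet_derivative u (at z) v)"
  by (rule fun_cong[OF frechet_derivative_at[symmetric]])
     (intro has_derivative_of_real smooth_has_derivative assms)

text \<open>\<open>del\<close> and \<open>delbar\<close> are the complex linear and antilinear parts
  \<open>(du(v) - i du(iv)) / 2\<close> and \<open>(du(v) + i du(iv)) / 2\<close> of
  \<open>du\<close>, so \<open>delbar - del\<close> is \<open>i du(iv)\<close>.\<close>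

lemma dc_eq:
  assumes u: "smooth u"
  shows "dc u z v = - frechet_derivative u (at z) (cI v) / 2"
proof -
  have "frechet_derivative u (at z) (cI v)
      = - Im (v $ 1) * frechet_derivative u (at z) (axis 1 1) + Re (v $ 1) * frechet_derivative u (at z) (axis 1 \<i>)
      - Im (v $ 2) * frechet_derivative u (at z) (axis 2 1) + Re (v $ 2) * frechet_derivative u (at z) (axis 2 \<i>)"
    by (subst linear_C2_expand[OF linear_frechet_derivative[OF u]]) simp
  then show ?thesis
    by (simp add: dc_def del_def delbar_def wirt_def wirt_bar_def frechet_derivative_of_real[OF u] sum_2 field_simps)
qed

lemma omega_eq:
  assumes u: "smooth u"
  shows "omega u z v w = (hess u z w (cI v) - hess u z v (cI w)) / 2"
proof -
  have "frechet_derivative (\<lambda>x. dc u x w) (at z) v = - hess u z v (cI w) / 2" for v w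
    unfolding dc_eq[OF u] hess_def
    by (rule fun_cong[OF frechet_derivative_at[symmetric]])
       (intro bounded_linear.has_derivative[OF bounded_linear_divide] has_derivative_minus smooth_has_derivative smooth_directional u)
  then show ?thesis
    by (simp add: omega_def ext_deriv_def diff_divide_distrib)
qed

text \<open>Both sides are a quarter of \<open>hess u z \<zeta> \<zeta> + hess u z (cI \<zeta>) (cI
  \<zeta>)\<close>. Through this identity strict plurisubharmonicity becomes positivity of
  \<open>omega u z v (cI v)\<close>.\<close>

lemma Levi_form_eq:
  assumes u: "smooth u"
  shows "Re (\<Sum>j\<in>UNIV. \<Sum>k\<in>UNIV.
               wirt j (wirt_bar k (\<lambda>w. complex_of_real (u w))) z * \<zeta> $ j * cnj (\<zeta> $ k))
       = omega u z \<zeta> (cI \<zeta>) / 2"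
proof -
  have "((\<lambda>w. wirt_bar k (\<lambda>w. complex_of_real (u w)) w) has_derivative
      (\<lambda>v. (complex_of_real (hess u z v (axis k 1)) + \<i> * complex_of_real (hess u z v (axis k \<i>))) / 2)) (at z)" for k
    unfolding wirt_bar_def frechet_derivative_of_real[OF u] hess_def
    by (intro bounded_linear.has_derivative[OF bounded_linear_divide] has_derivative_add has_derivative_mult_right has_derivative_of_real
        smooth_has_derivative smooth_directional u)
  from frechet_derivative_at[OF this, symmetric]
  have w: "wirt j (wirt_bar k (\<lambda>w. complex_of_real (u w))) z =
     Complex ((hess u z (axis j 1) (axis k 1) + hess u z (axis j \<i>) (axis k \<i>)) / 4)
             ((hess u z (axis j 1) (axis k \<i>) - hess u z (axis j \<i>) (axis k 1)) / 4)" for j k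
    by (simp add: wirt_def complex_eq_iff)
  note L = linear_C2_expand[OF linear_hess_left[OF u], of z]
  note R = linear_C2_expand[OF linear_hess_right[OF u], of z]
  have h: "hess u z v v =
      Re (v $ 1) * (Re (v $ 1) * hess u z (axis 1 1) (axis 1 1) + Im (v $ 1) * hess u z (axis 1 1) (axis 1 \<i>)
        + Re (v $ 2) * hess u z (axis 1 1) (axis 2 1) + Im (v $ 2) * hess u z (axis 1 1) (axis 2 \<i>))
    + Im (v $ 1) * (Re (v $ 1) * hess u z (axis 1 \<i>) (axis 1 1) + Im (v $ 1) * hess u z (axis 1 \<i>) (axis 1 \<i>)
        + Re (v $ 2) * hess u z (axis 1 \<i>) (axis 2 1) + Im (v $ 2) * hess u z (axis 1 \<i>) (axis 2 \<i>))
    + Re (v $ 2) * (Re (v $ 1) * hess u z (axis 2 1) (axis 1 1) + Im (v $ 1) * hess u z (axis 2 1) (axis 1 \<i>)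
        + Re (v $ 2) * hess u z (axis 2 1) (axis 2 1) + Im (v $ 2) * hess u z (axis 2 1) (axis 2 \<i>))
    + Im (v $ 2) * (Re (v $ 1) * hess u z (axis 2 \<i>) (axis 1 1) + Im (v $ 1) * hess u z (axis 2 \<i>) (axis 1 \<i>)
        + Re (v $ 2) * hess u z (axis 2 \<i>) (axis 2 1) + Im (v $ 2) * hess u z (axis 2 \<i>) (axis 2 \<i>))" for v
    by (subst L, subst (1 2 3 4) R) (rule refl)
  have c: "hess u z (axis 1 \<i>) (axis 1 1) = hess u z (axis 1 1) (axis 1 \<i>)"
    "hess u z (axis 2 1) (axis 1 1) = hess u z (axis 1 1) (axis 2 1)"
    "hess u z (axis 2 \<i>) (axis 1 1) = hess u z (axis 1 1) (axis 2 \<i>)"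
    "hess u z (axis 2 1) (axis 1 \<i>) = hess u z (axis 1 \<i>) (axis 2 1)"
    "hess u z (axis 2 \<i>) (axis 1 \<i>) = hess u z (axis 1 \<i>) (axis 2 \<i>)"
    "hess u z (axis 2 \<i>) (axis 2 1) = hess u z (axis 2 1) (axis 2 \<i>)"
    by (rule hess_commute[OF u])+
  have "omega u z \<zeta> (cI \<zeta>) = (hess u z (cI \<zeta>) (cI \<zeta>) + hess u z \<zeta> \<zeta>) / 2"
    by (simp add: omega_eq[OF u] quaternion_relations linear_neg[OF linear_hess_right[OF u]])
  then show ?thesis
    unfolding h[of \<zeta>] h[of "cI \<zeta>"] w by (simp add: sum_2 c field_simps)
qed

lemma omega_antisym: "smooth u \<Longrightarrow> omega u z w v = - omega u z v w"
  by (simp only: omega_eq minus_divide_left minus_diff_eq)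

text \<open>This is the (1,1)-type of \<open>omega u\<close>; it rests on the symmetry of
  \<open>hess\<close>.\<close>

lemma omega_cI_cI: "smooth u \<Longrightarrow> omega u z (cI v) (cI w) = omega u z v w"
  by (simp add: omega_eq quaternion_relations linear_neg[OF linear_hess_right]
      hess_commute[of u z "cI _"])

lemma linear_omega_right:
  assumes u: "smooth u"
  shows "linear (omega u z v)"
proof (rule linearI)
  note l = linear_hess_left[OF u, of z "cI v"] linear_hess_right[OF u, of z v]
  show "omega u z v (a + b) = omega u z v a + omega u z v b" for a b
    by (simp add: omega_eq[OF u] linear_add[OF l(1)] linear_add[OF l(2)] linear_add[OF linear_cI] field_simps)
  show "omega u z v (c *\<^sub>R a) = c *\<^sub>R omega u z v a" for a c
    by (simp add: omega_eq[OF u] linear_cmul[OF l(1)] linear_cmul[OF l(2)] linear_cmul[OF linear_cI] field_simps)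
qed

lemma linear_omega_left:
  assumes u: "smooth u"
  shows "linear (\<lambda>v. omega u z v w)"
  using linear_compose_neg[OF linear_omega_right[OF u, of z w]]
  by (simp add: omega_antisym[OF u, symmetric])

lemma omega_axis:
  assumes u: "smooth u"
  shows "omega u z (axis 1 \<i>) (axis 2 \<i>) = omega u z (axis 1 1) (axis 2 1)"
    and "omega u z (axis 1 \<i>) (axis 2 1) = - omega u z (axis 1 1) (axis 2 \<i>)"
proof -
  have "axis 2 (-1) = (- axis 2 1 :: C2)"
    by (simp add: vec_eq_iff axis_def)
  then show "omega u z (axis 1 \<i>) (axis 2 1) = - omega u z (axis 1 1) (axis 2 \<i>)"
    using omega_cI_cI[OF u, of z "axis 1 1" "axis 2 \<i>"] linear_neg[OF linear_omega_right[OF u], of z _ "axis 2 1"]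
    by (simp add: cI_axis)
  show "omega u z (axis 1 \<i>) (axis 2 \<i>) = omega u z (axis 1 1) (axis 2 1)"
    using omega_cI_cI[OF u, of z "axis 1 1" "axis 2 1"] by (simp add: cI_axis)
qed

text \<open>Antisymmetry and invariance under \<open>cI\<close> leave four coefficients: the
  diagonal of a Hermitian 2 by 2 matrix and the real and imaginary parts of its off-diagonal entry,
  up to sign.\<close>

lemma omega_expand:
  assumes u: "smooth u"
  shows "omega u z v w =
      omega u z (axis 1 1) (axis 1 \<i>) * (Re (v $ 1) * Im (w $ 1) - Im (v $ 1) * Re (w $ 1))
    + omega u z (axis 2 1) (axis 2 \<i>) * (Re (v $ 2) * Im (w $ 2) - Im (v $ 2) * Re (w $ 2))
    + omega u z (axis 1 1) (axis 2 1) * (Re (v $ 1) * Re (w $ 2) + Im (v $ 1) * Im (w $ 2)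
        - Re (v $ 2) * Re (w $ 1) - Im (v $ 2) * Im (w $ 1))
    + omega u z (axis 1 1) (axis 2 \<i>) * (Re (v $ 1) * Im (w $ 2) - Im (v $ 1) * Re (w $ 2)
        - Im (v $ 2) * Re (w $ 1) + Re (v $ 2) * Im (w $ 1))"
proof -
  have 0: "omega u z a a = 0" for a
    using omega_antisym[OF u, of z a a] by simp
  have 1: "omega u z (axis 1 \<i>) (axis 1 1) = - omega u z (axis 1 1) (axis 1 \<i>)"
    "omega u z (axis 2 \<i>) (axis 2 1) = - omega u z (axis 2 1) (axis 2 \<i>)"
    "omega u z (axis 2 1) (axis 1 1) = - omega u z (axis 1 1) (axis 2 1)"
    "omega u z (axis 2 \<i>) (axis 1 1) = - omega u z (axis 1 1) (axis 2 \<i>)"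
    by (rule omega_antisym[OF u])+
  note 2 = omega_axis[OF u]
  have 4: "omega u z (axis 2 \<i>) (axis 1 \<i>) = - omega u z (axis 1 1) (axis 2 1)"
    "omega u z (axis 2 1) (axis 1 \<i>) = omega u z (axis 1 1) (axis 2 \<i>)"
    by (subst omega_antisym[OF u], simp add: 2)+
  show ?thesis
    by (subst linear_C2_expand[OF linear_omega_left[OF u]], subst (1 2 3 4) linear_C2_expand[OF linear_omega_right[OF u]])
       (simp add: 0 1 2 4 algebra_simps)
qed

section \<open>The Monge-Ampere density\<close>

definition MA_density :: "(C2 \<Rightarrow> real) \<Rightarrow> C2 \<Rightarrow> real" where
  "MA_density u z = wedge (omega u) (omega u) z (axis 1 1) (axis 1 \<i>) (axis 2 1) (axis 2 \<i>)"

text \<open>The bracket is the determinant of the Hermitian matrix behind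
  \<open>omega_expand\<close>.\<close>

lemma MA_density_eq:
  assumes u: "smooth u"
  shows "MA_density u z = 2 * (omega u z (axis 1 1) (axis 1 \<i>) * omega u z (axis 2 1) (axis 2 \<i>)
     - (omega u z (axis 1 1) (axis 2 1))\<^sup>2 - (omega u z (axis 1 1) (axis 2 \<i>))\<^sup>2)"
  unfolding MA_density_def wedge_def
  by (simp add: omega_axis[OF u] power2_eq_square)

text \<open>The frame \<open>z, cI z, cX z, cY z\<close> is orthogonal and oriented with all lengths
  \<open>norm z\<close>, so a 4-form evaluated on it picks up the factor \<open>norm z ^ 4\<close>;
  the symmetry under \<open>cI\<close> yields the same determinant formula as for the standard
  frame.\<close>

lemma MA_density_frame:
  assumes u: "smooth u"
  shows "norm z ^ 4 * MA_density u z = 2 * (omega u z z (cI z) * omega u z (cX z) (cY z)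
     - (omega u z z (cX z))\<^sup>2 - (omega u z z (cY z))\<^sup>2)"
proof -
  have n: "norm z ^ 4 = ((Re (z $ 1))\<^sup>2 + (Im (z $ 1))\<^sup>2 + (Re (z $ 2))\<^sup>2 + (Im (z $ 2))\<^sup>2)\<^sup>2"
    using norm_C2[of z] by (metis power_even_eq numeral_Bit0 mult_2)
  show ?thesis
    unfolding n MA_density_eq[OF u] omega_expand[OF u, of z z] omega_expand[OF u, of z "cX z"]
    by (simp add: power2_eq_square) algebra
qed

lemma omega_pos:
  assumes "smooth u" "strictly_psh u" "v \<noteq> 0"
  shows "0 < omega u z v (cI v)"
proof -
  have "0 < omega u z v (cI v) / 2"
    unfolding Levi_form_eq[OF assms(1), symmetric] using assms(2,3) unfolding strictly_psh_def by blast
  then show ?thesis by simp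
qed

lemma omega_nonneg:
  assumes "smooth u" "strictly_psh u"
  shows "0 \<le> omega u z v (cI v)"
proof (cases "v = 0")
  case True
  then show ?thesis using assms by (simp add: linear_0[OF linear_omega_left])
qed (use omega_pos[OF assms] in \<open>simp add: less_imp_le\<close>)

lemma MA_density_nonneg:
  assumes u: "smooth u" "strictly_psh u"
  shows "0 \<le> MA_density u z"
proof -
  define a b c where "a = omega u z (axis 1 1) (axis 1 \<i>)" and "b = omega u z (axis 1 1) (axis 2 1)"
    and "c = omega u z (axis 1 1) (axis 2 \<i>)"
  have a: "0 < a"
    using omega_pos[OF u, of "axis 1 1" z] by (simp add: cI_axis a_def axis_eq_0_iff)
  \<comment> \<open>Completing the square: with the second coordinate fixed to \<open>a\<close>,
    this first coordinate minimises \<open>omega u z v (cI v)\<close>, and the minimum is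
    \<open>a\<close> times the determinant.\<close>
  define v :: C2 where "v = (\<chi> k. if k = 1 then Complex (- c) (- b) else Complex a 0)"
  have "a * MA_density u z = 2 * omega u z v (cI v)"
    unfolding MA_density_eq[OF u(1)] omega_expand[OF u(1), of z v]
    by (simp add: v_def a_def[symmetric] b_def[symmetric] c_def[symmetric] power2_eq_square algebra_simps)
  then have "0 \<le> a * MA_density u z"
    using omega_nonneg[OF u] by simp
  with a show ?thesis
    by (simp add: zero_le_mult_iff)
qed

section \<open>Monge-Ampere mass as a flux through the sphere\<close>

abbreviation "DE \<equiv> fieldderiv (\<lambda>z::C2. z)"
abbreviation "DI \<equiv> fieldderiv cI"
abbreviation "DX \<equiv> fieldderiv cX"
abbreviation "DY \<equiv> fieldderiv cY"

lemma smooth_frame: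
  "smooth f \<Longrightarrow> smooth (DE f)" "smooth f \<Longrightarrow> smooth (DI f)" "smooth f \<Longrightarrow> smooth (DX f)" "smooth f \<Longrightarrow> smooth (DY f)"
  by (intro smooth_fieldderiv linear_cI linear_cX linear_cY linear_id[unfolded id_def]; assumption)+

lemmas smooth_intros = smooth_frame smooth_add smooth_diff smooth_mult smooth_power2 smooth_const

text \<open>The Euler field commutes with every linear field. Two different quaternion units
  anticommute, so the commutator of two rotation fields is twice the third one up to sign.\<close>

lemma frame_commute:
  assumes f: "smooth f"
  shows "DE (DI f) z = DI (DE f) z" "DE (DX f) z = DX (DE f) z" "DE (DY f) z = DY (DE f) z"
    "DI (DX f) z = DX (DI f) z - 2 * DY f z"
    "DI (DY f) z = DY (DI f) z + 2 * DX f z"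
    "DX (DY f) z = DY (DX f) z - 2 * DI f z"
proof -
  have lE: "linear (\<lambda>z::C2. z)" by (rule linear_id[unfolded id_def])
  note ff = fieldderiv_fieldderiv[OF f lE] fieldderiv_fieldderiv[OF f linear_cI]
    fieldderiv_fieldderiv[OF f linear_cX] fieldderiv_fieldderiv[OF f linear_cY]
  note neg = linear_neg[OF linear_frechet_derivative[OF f]]
  show "DE (DI f) z = DI (DE f) z" "DE (DX f) z = DX (DE f) z" "DE (DY f) z = DY (DE f) z"
    by (simp_all add: ff hess_commute[OF f, of z z "cI z"] hess_commute[OF f, of z z "cX z"] hess_commute[OF f, of z z "cY z"])
  show "DI (DX f) z = DX (DI f) z - 2 * DY f z"
    by (simp add: ff quaternion_relations neg hess_commute[OF f, of z "cI z" "cX z"] fieldderiv_def[of _ f])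
  show "DI (DY f) z = DY (DI f) z + 2 * DX f z"
    by (simp add: ff quaternion_relations neg hess_commute[OF f, of z "cI z" "cY z"] fieldderiv_def[of _ f])
  show "DX (DY f) z = DY (DX f) z - 2 * DI f z"
    by (simp add: ff quaternion_relations neg hess_commute[OF f, of z "cX z" "cY z"] fieldderiv_def[of _ f])
qed

lemma sphere_int_frame:
  assumes "smooth f"
  shows "sphere_int t (DI f) = 0" "sphere_int t (DX f) = 0" "sphere_int t (DY f) = 0"
  by (intro sphere_int_fieldderiv_rotation assms linear_cI linear_cX linear_cY norm_rotations inner_rotations)+

text \<open>Second frame derivatives differ from \<open>hess\<close> by first-order terms. For
  \<open>DE (DE u)\<close> and \<open>DI (DI u)\<close> these cancel, whereas
  \<open>DX (DX u)\<close> and \<open>DY (DY u)\<close> contribute \<open>- DE u\<close> each, which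
  the summand \<open>DE u\<close> corrects.\<close>

lemma omega_frame:
  assumes u: "smooth u"
  shows "omega u z z (cI z) = (DE (DE u) z + DI (DI u) z) / 2"
    "omega u z (cX z) (cY z) = (DX (DX u) z + DY (DY u) z) / 2 + DE u z"
    "omega u z z (cX z) = (DX (DI u) z - DY (DE u) z) / 2"
    "omega u z z (cY z) = (DX (DE u) z + DY (DI u) z) / 2"
proof -
  have lE: "linear (\<lambda>z::C2. z)" by (rule linear_id[unfolded id_def])
  note ff = fieldderiv_fieldderiv[OF u lE] fieldderiv_fieldderiv[OF u linear_cI]
    fieldderiv_fieldderiv[OF u linear_cX] fieldderiv_fieldderiv[OF u linear_cY]
  note neg = linear_neg[OF linear_frechet_derivative[OF u]] linear_neg[OF linear_hess_right[OF u]]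
  show "omega u z z (cI z) = (DE (DE u) z + DI (DI u) z) / 2"
    "omega u z (cX z) (cY z) = (DX (DX u) z + DY (DY u) z) / 2 + DE u z"
    "omega u z z (cX z) = (DX (DI u) z - DY (DE u) z) / 2"
    "omega u z z (cY z) = (DX (DE u) z + DY (DI u) z) / 2"
    by (simp_all add: omega_eq[OF u] ff quaternion_relations neg fieldderiv_def[of _ u]
        hess_commute[OF u, of z z "cI z"] hess_commute[OF u, of z z "cX z"] hess_commute[OF u, of z z "cY z"]
        hess_commute[OF u, of z "cI z" "cX z"] hess_commute[OF u, of z "cI z" "cY z"] field_simps)
qed

lemma smooth_omega: "smooth u \<Longrightarrow> smooth (\<lambda>z. omega u z v w)"
  unfolding omega_eq hess_def diff_divide_distrib divide_inverse
  by (intro smooth_diff smooth_mult smooth_directional smooth_const)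

lemma smooth_MA_density:
  assumes "smooth u"
  shows "smooth (MA_density u)"
proof -
  have "MA_density u = (\<lambda>z. 2 * (omega u z (axis 1 1) (axis 1 \<i>) * omega u z (axis 2 1) (axis 2 \<i>)
     - (omega u z (axis 1 1) (axis 2 1))\<^sup>2 - (omega u z (axis 1 1) (axis 2 \<i>))\<^sup>2))"
    by (rule ext) (rule MA_density_eq[OF assms])
  then show ?thesis
    by (simp only:) (intro smooth_intros smooth_omega assms)
qed

text \<open>Up to a constant and to terms that integrate to zero over spheres, this is the 3-form
  \<open>d\<^sup>cu \<and> dd\<^sup>cu\<close> evaluated on the tangent frame \<open>cI, cX, cY\<close>.\<close>

definition flux_density :: "(C2 \<Rightarrow> real) \<Rightarrow> C2 \<Rightarrow> real" where
  "flux_density u z = (DE u z)\<^sup>2 + (DI u z)\<^sup>2 - DX u z * DX (DE u) z - DY u z * DY (DE u) z"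

lemma smooth_flux_density: "smooth u \<Longrightarrow> smooth (flux_density u)"
  unfolding flux_density_def[abs_def] by (intro smooth_intros)

text \<open>The Leibniz rule run backwards on the frame determinant: products of second derivatives
  become derivatives of products, chosen so that all third-order terms cancel once the fields are
  commuted. With \<open>p = DE u\<close> and \<open>q = DI u\<close>, the commutator of
  \<open>DX\<close> and \<open>DY\<close> on \<open>p\<close> leaves \<open>- 4 * q * DI p\<close>,
  balanced by \<open>2 * q * DI p\<close> from the \<open>DE\<close> term and again from the
  \<open>DI\<close> term.\<close>

lemma MA_density_divergence:
  assumes u: "smooth u"
  shows "2 * (norm z ^ 4 * MA_density u z) = DE (flux_density u) z
    + DX (\<lambda>z. DX u z * DE (DE u) z + 2 * DI u z * DY (DE u) z + DX u z * DI (DI u) z) z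
    + DY (\<lambda>z. DY u z * DE (DE u) z - 2 * DI u z * DX (DE u) z + DY u z * DI (DI u) z) z
    + DI (\<lambda>z. 2 * DE u z * DI u z - (DX u z * DX (DI u) z + DY u z * DY (DI u) z)) z"
proof -
  define p q a b where "p = DE u" and "q = DI u" and "a = DX u" and "b = DY u"
  have sm: "smooth p" "smooth q" "smooth a" "smooth b"
    by (simp_all add: p_def q_def a_def b_def smooth_frame u)
  note sm' = sm smooth_frame[OF sm(1)] smooth_frame[OF sm(2)]
  have c: "DE q z = DI p z" "DE a z = DX p z" "DE b z = DY p z"
      "DI a z = DX q z - 2 * b z" "DI b z = DY q z + 2 * a z"
    by (simp_all add: p_def q_def a_def b_def frame_commute u)
  have cp: "DE (DX p) z = DX (DE p) z" "DE (DY p) z = DY (DE p) z" "DX (DY p) z = DY (DX p) z - 2 * DI p z"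
    and cq: "DI (DX q) z = DX (DI q) z - 2 * DY q z" "DI (DY q) z = DY (DI q) z + 2 * DX q z"
    by (rule frame_commute[OF sm(1)] frame_commute[OF sm(2)])+
  have dE: "DE (\<lambda>z. (p z)\<^sup>2 + (q z)\<^sup>2 - a z * DX p z - b z * DY p z) z
      = 2 * p z * DE p z + 2 * q z * DI p z - (a z * DX (DE p) z + DX p z * DX p z)
        - (b z * DY (DE p) z + DY p z * DY p z)"
    by (simp add: fieldderiv_add fieldderiv_diff fieldderiv_mult fieldderiv_power2 smooth_add smooth_diff smooth_mult
        smooth_power2 sm' c cp)
  have dX: "DX (\<lambda>z. a z * DE p z + 2 * q z * DY p z + a z * DI q z) z
      = a z * DX (DE p) z + DX a z * DE p z + (2 * q z * (DY (DX p) z - 2 * DI p z) + 2 * DX q z * DY p z)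
        + (a z * DX (DI q) z + DX a z * DI q z)"
    by (simp add: fieldderiv_add fieldderiv_diff fieldderiv_mult fieldderiv_const smooth_add smooth_diff smooth_mult
        smooth_const sm' c cp)
  have dY: "DY (\<lambda>z. b z * DE p z - 2 * q z * DX p z + b z * DI q z) z
      = b z * DY (DE p) z + DY b z * DE p z - (2 * q z * DY (DX p) z + 2 * DY q z * DX p z)
        + (b z * DY (DI q) z + DY b z * DI q z)"
    by (simp add: fieldderiv_add fieldderiv_diff fieldderiv_mult fieldderiv_const smooth_add smooth_diff smooth_mult
        smooth_const sm' c cp)
  have dI: "DI (\<lambda>z. 2 * p z * q z - (a z * DX q z + b z * DY q z)) z
      = 2 * p z * DI q z + 2 * DI p z * q z
        - (a z * (DX (DI q) z - 2 * DY q z) + (DX q z - 2 * b z) * DX q z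
          + (b z * (DY (DI q) z + 2 * DX q z) + (DY q z + 2 * a z) * DY q z))"
    by (simp add: fieldderiv_add fieldderiv_diff fieldderiv_mult fieldderiv_const smooth_add smooth_diff smooth_mult
        smooth_const sm' c cq)
  show ?thesis
    unfolding MA_density_frame[OF u] omega_frame[OF u] flux_density_def[abs_def]
      p_def[symmetric] q_def[symmetric] a_def[symmetric] b_def[symmetric] dE dX dY dI
    by (simp add: power2_eq_square field_simps)
qed

text \<open>On the sphere \<open>norm z ^ 4\<close> is \<open>t ^ 4\<close>, and only the Euler part
  of the divergence survives integration.\<close>

lemma sphere_int_MA_density:
  assumes u: "smooth u"
  shows "2 * t ^ 4 * sphere_int t (MA_density u) = sphere_int t (DE (flux_density u))"
proof -
  let ?a = "DX (\<lambda>z. DX u z * DE (DE u) z + 2 * DI u z * DY (DE u) z + DX u z * DI (DI u) z)"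
  let ?b = "DY (\<lambda>z. DY u z * DE (DE u) z - 2 * DI u z * DX (DE u) z + DY u z * DI (DI u) z)"
  let ?c = "DI (\<lambda>z. 2 * DE u z * DI u z - (DX u z * DX (DI u) z + DY u z * DY (DI u) z))"
  have s: "smooth ?a" "smooth ?b" "smooth ?c" "smooth (DE (flux_density u))"
    by (intro smooth_intros smooth_flux_density u)+
  have "2 * t ^ 4 * sphere_int t (MA_density u) = (\<integral>x. 2 * (norm (t *\<^sub>R x) ^ 4 * MA_density u (t *\<^sub>R x)) \<partial>cone_measure)"
    unfolding sphere_int_def integral_mult_right_zero[symmetric]
  proof (rule integral_cong_AE)
    show "AE x in cone_measure. 2 * t ^ 4 * MA_density u (t *\<^sub>R x) = 2 * (norm (t *\<^sub>R x) ^ 4 * MA_density u (t *\<^sub>R x))"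
      using AE_cone_measure_norm by eventually_elim simp
    have [measurable]: "(\<lambda>x. MA_density u (t *\<^sub>R x)) \<in> borel_measurable cone_measure"
      using integrable_sphere_int[OF smooth_MA_density[OF u]] by (rule borel_measurable_integrable)
    show "(\<lambda>x. 2 * t ^ 4 * MA_density u (t *\<^sub>R x)) \<in> borel_measurable cone_measure"
      "(\<lambda>x. 2 * (norm (t *\<^sub>R x) ^ 4 * MA_density u (t *\<^sub>R x))) \<in> borel_measurable cone_measure"
      by measurable
  qed
  also have "\<dots> = sphere_int t (\<lambda>z. DE (flux_density u) z + ?a z + ?b z + ?c z)"
    unfolding sphere_int_def MA_density_divergence[OF u] by (rule refl)
  also have "\<dots> = sphere_int t (DE (flux_density u)) + sphere_int t ?a + sphere_int t ?b + sphere_int t ?c"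
    by (simp add: sphere_int_add smooth_add s)
  also have "sphere_int t ?a = 0" by (intro sphere_int_frame smooth_intros u)
  also have "sphere_int t ?b = 0" by (intro sphere_int_frame smooth_intros u)
  also have "sphere_int t ?c = 0" by (intro sphere_int_frame smooth_intros u)
  finally show ?thesis by simp
qed

lemma fieldderiv_zero: "smooth f \<Longrightarrow> linear L \<Longrightarrow> fieldderiv L f 0 = 0"
  by (simp add: fieldderiv_def linear_0 linear_0[OF linear_frechet_derivative])

lemma form_integral_MA:
  assumes u: "smooth u" "strictly_psh u" and R: "0 < R"
  shows "form_integral (ball 0 R) (wedge (omega u) (omega u)) = 2 * sphere_int R (flux_density u)"
proof -
  \<comment> \<open>\<open>4 * t ^ 3\<close> is the polar coordinate factor in real dimension 4, so
    \<open>K' t\<close> is the Monge-Ampere mass per unit of radius.\<close>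
  define K' where "K' t = 4 * t ^ 3 * sphere_int t (MA_density u)" for t
  have sM: "smooth (MA_density u)" by (rule smooth_MA_density[OF u(1)])
  have [measurable]: "MA_density u \<in> borel_measurable borel"
    by (rule borel_measurable_continuous_onI[OF smooth_continuous_on[OF sM]])
  have inner: "0 \<le> sphere_int t (MA_density u)"
    "(\<integral>\<^sup>+x. ennreal (MA_density u (t *\<^sub>R x)) \<partial>cone_measure) = ennreal (sphere_int t (MA_density u))" for t
    unfolding sphere_int_def
    by (auto intro!: Bochner_Integration.integral_nonneg nn_integral_eq_integral integrable_sphere_int[OF sM] MA_density_nonneg[OF u])
  have der: "((\<lambda>t. 2 * sphere_int t (flux_density u)) has_real_derivative K' t) (at t)" if "0 < t" for t
  proof -
    have "K' t = 2 * (sphere_int t (DE (flux_density u)) / t)"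
      unfolding K'_def sphere_int_MA_density[OF u(1), symmetric] using that by (simp add: field_simps power_eq_if)
    then show ?thesis
      using DERIV_cmult[OF sphere_int_has_real_derivative[OF smooth_flux_density[OF u(1)], of t], of 2] that by simp
  qed
  \<comment> \<open>The frame fields vanish at the origin, so the flux has no boundary term at
    radius 0.\<close>
  have zero: "flux_density u 0 = 0"
    by (simp add: flux_density_def fieldderiv_zero u smooth_frame linear_cI linear_cX linear_cY linear_id[unfolded id_def])
  have "(K' has_integral 2 * sphere_int R (flux_density u) - 2 * sphere_int 0 (flux_density u)) {0..R}"
  \<comment> \<open>\<open>der\<close> holds for positive radii; continuity takes care of the
    endpoint 0.\<close>
  proof (rule fundamental_theorem_of_calculus_interior)
    show "continuous_on {0..R} (\<lambda>t. 2 * sphere_int t (flux_density u))"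
      by (intro continuous_intros continuous_on_sphere_int smooth_flux_density u)
    show "((\<lambda>t. 2 * sphere_int t (flux_density u)) has_vector_derivative K' t) (at t)" if "t \<in> {0<..<R}" for t
      using der that by (simp add: has_real_derivative_iff_has_vector_derivative)
  qed (use R in simp)
  then have "(K' has_integral 2 * sphere_int R (flux_density u)) {0<..<R}"
    by (simp add: sphere_int_zero zero has_integral_Icc_iff_Ioo)
  from nn_integral_has_integral_lebesgue'[OF _ this]
  have K: "(\<integral>\<^sup>+t. ennreal (K' t) * indicator {0<..<R} t \<partial>lborel) = ennreal (2 * sphere_int R (flux_density u))"
    using inner(1) by (simp add: K'_def)
  have "(\<integral>\<^sup>+z. ennreal (MA_density u z) * indicator (ball 0 R) z \<partial>lborel)
     = (\<integral>\<^sup>+t. ennreal (4 * t ^ 3) * ennreal (sphere_int t (MA_density u)) * indicator {0<..<R} t \<partial>lborel)"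
    by (subst nn_integral_polar) (simp_all add: inner(2))
  also have "\<dots> = (\<integral>\<^sup>+t. ennreal (K' t) * indicator {0<..<R} t \<partial>lborel)"
    using inner(1) by (intro nn_integral_cong) (auto simp: indicator_def K'_def ennreal_mult)
  also note K
  finally have nn: "(\<integral>\<^sup>+z. ennreal (MA_density u z) * indicator (ball 0 R) z \<partial>lborel) = ennreal (2 * sphere_int R (flux_density u))" .
  have nonneg: "0 \<le> 2 * sphere_int R (flux_density u)"
    by (rule has_integral_nonneg[OF \<open>(K' has_integral 2 * sphere_int R (flux_density u)) {0<..<R}\<close>])
       (use inner(1) in \<open>simp add: K'_def\<close>)
  have "form_integral (ball 0 R) (wedge (omega u) (omega u)) = (\<integral>z. indicator (ball 0 R) z * MA_density u z \<partial>lborel)"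
    by (simp add: form_integral_def set_lebesgue_integral_def MA_density_def)
  also have "\<dots> = enn2real (\<integral>\<^sup>+z. ennreal (indicator (ball 0 R) z * MA_density u z) \<partial>lborel)"
    by (rule integral_eq_nn_integral) (auto simp: MA_density_nonneg[OF u])
  also have "(\<lambda>z. ennreal (indicator (ball 0 R) z * MA_density u z)) = (\<lambda>z. ennreal (MA_density u z) * indicator (ball 0 R) z)"
    by (auto simp: indicator_def)
  finally show ?thesis
    using nn nonneg by simp
qed

lemma flux_bound:
  assumes u: "smooth u" "strictly_psh u" and R: "0 < R"
    and m: "\<And>z. norm z \<le> R \<Longrightarrow> \<bar>DE u z\<bar> \<le> m"
  shows "sphere_int R (flux_density u) \<le> 4 * m * sphere_int R (DE u)"
    and "0 \<le> sphere_int R (DE u)"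
proof -
  \<comment> \<open>\<open>wE\<close> and \<open>wX\<close> are \<open>omega(E,I)\<close> and
    \<open>omega(X,Y)\<close> in frame derivatives; both have the form
    \<open>omega u z v (cI v)\<close>, hence \<open>pos\<close>.\<close>
  define wE where "wE z = (DE (DE u) z + DI (DI u) z) / 2" for z
  define wX where "wX z = (DX (DX u) z + DY (DY u) z) / 2 + DE u z" for z
  have pos: "0 \<le> wE z" "0 \<le> wX z" for z
    using omega_nonneg[OF u, of z z] omega_nonneg[OF u, of z "cX z"]
    by (simp_all add: wE_def wX_def omega_frame[OF u(1), symmetric] quaternion_relations)
  have sw: "smooth wE" "smooth wX"
    unfolding wE_def[abs_def] wX_def[abs_def] divide_inverse by (intro smooth_intros u)+
  note sm = u(1) smooth_frame[OF u(1)] smooth_frame[OF smooth_frame(1)[OF u(1)]]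
    smooth_frame[OF smooth_frame(2)[OF u(1)]] smooth_frame[OF smooth_frame(3)[OF u(1)]] smooth_frame[OF smooth_frame(4)[OF u(1)]]
  have IwX: "sphere_int t wX = sphere_int t (DE u)" for t
  proof -
    have "wX = (\<lambda>z. (1/2) * (DX (DX u) z + DY (DY u) z) + DE u z)"
      by (simp add: wX_def fun_eq_iff)
    then show ?thesis
      by (simp add: sphere_int_add sphere_int_cmult sm smooth_intros sphere_int_frame del: times_divide_eq_left)
  qed
  have IwE: "2 * sphere_int t wE = sphere_int t (DE (DE u))" for t
  proof -
    have "wE = (\<lambda>z. (1/2) * (DE (DE u) z + DI (DI u) z))"
      by (simp add: wE_def fun_eq_iff)
    then show ?thesis
      by (simp add: sphere_int_add sphere_int_cmult sm smooth_intros sphere_int_frame del: times_divide_eq_left)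
  qed
  show p0: "0 \<le> sphere_int R (DE u)"
  proof -
    have "sphere_int R (\<lambda>_::C2. 0) \<le> sphere_int R wX"
      by (rule sphere_int_mono) (simp_all add: pos sw smooth_const)
    then show ?thesis
      unfolding IwX by (simp add: sphere_int_def)
  qed
  \<comment> \<open>The Leibniz rule moves \<open>DX\<close> and \<open>DY\<close> off
    \<open>DE u\<close>. The resulting \<open>DX (DX u) + DY (DY u)\<close> is
    \<open>2 * wX - 2 * DE u\<close>, which flips the sign of the square of
    \<open>DE u\<close>.\<close>
  have flux: "flux_density u = (\<lambda>z. 2 * (DE u z * wX z) - ((DE u z)\<^sup>2 - (DI u z)\<^sup>2)
      - (DX (\<lambda>z. DX u z * DE u z) z + DY (\<lambda>z. DY u z * DE u z) z))"
    by (rule ext) (simp add: flux_density_def wX_def fieldderiv_mult sm field_simps power2_eq_square)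
  have 1: "sphere_int R (flux_density u) = 2 * sphere_int R (\<lambda>z. DE u z * wX z) - sphere_int R (\<lambda>z. (DE u z)\<^sup>2 - (DI u z)\<^sup>2)"
    unfolding flux
    by (simp add: sphere_int_add sphere_int_diff sphere_int_cmult sm sw smooth_intros sphere_int_frame)
  have 2: "sphere_int R (\<lambda>z. DE u z * wX z) \<le> m * sphere_int R (DE u)"
  proof -
    have "sphere_int R (\<lambda>z. DE u z * wX z) \<le> sphere_int R (\<lambda>z. m * wX z)"
    proof (rule sphere_int_mono)
      show "DE u z * wX z \<le> m * wX z" if "norm z = \<bar>R\<bar>" for z
        using m[of z] that R pos by (intro mult_right_mono) auto
    qed (intro smooth_intros sw u)+
    then show ?thesis by (simp add: sphere_int_cmult IwX)
  qed
  \<comment> \<open>The second summand makes \<open>F\<close> increasing. Since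
    \<open>F 0 = 0\<close>, the first summand is at least
    \<open>- 2 * m * sphere_int R (DE u)\<close> at radius \<open>R\<close>.\<close>
  define F where "F t = sphere_int t (\<lambda>z. (DE u z)\<^sup>2 - (DI u z)\<^sup>2) + 2 * m * sphere_int t (DE u)" for t
  have "F 0 \<le> F R"
  proof (rule DERIV_nonneg_imp_increasing_open[where f = F])
    show "continuous_on {0..R} F"
      unfolding F_def by (intro continuous_intros continuous_on_sphere_int smooth_intros u)
    fix t assume t: "0 < t" "t < R"
    \<comment> \<open>With \<open>p = DE u\<close> and \<open>q = DI u\<close>, commuting the fields
      turns \<open>- 2 * q * DE q\<close> into \<open>- 2 * q * DI p\<close>. Up to the rotation
      derivative of \<open>p * q\<close> this is \<open>2 * p * DI q\<close>, which joins
      \<open>2 * p * DE p\<close> to form \<open>4 * p * wE\<close>.\<close>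
    have e: "DE (\<lambda>z. (DE u z)\<^sup>2 - (DI u z)\<^sup>2) = (\<lambda>z. 4 * (DE u z * wE z) - 2 * DI (\<lambda>z. DE u z * DI u z) z)"
      by (rule ext) (simp add: wE_def fieldderiv_mult fieldderiv_diff fieldderiv_power2 smooth_intros sm frame_commute field_simps)
    have "sphere_int t (\<lambda>z. (- m) * wE z) \<le> sphere_int t (\<lambda>z. DE u z * wE z)"
    proof (rule sphere_int_mono)
      show "(- m) * wE z \<le> DE u z * wE z" if "norm z = \<bar>t\<bar>" for z
        using m[of z] that t pos by (intro mult_right_mono) auto
    qed (intro smooth_intros sw u)+
    then have ge: "- m * sphere_int t (DE (DE u)) \<le> 2 * sphere_int t (\<lambda>z. DE u z * wE z)"
      using sphere_int_cmult[of t "- m" wE] by (simp add: IwE[symmetric])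
    have eq: "4 * sphere_int t (\<lambda>z. DE u z * wE z) = sphere_int t (DE (\<lambda>z. (DE u z)\<^sup>2 - (DI u z)\<^sup>2))"
      unfolding e by (simp add: sphere_int_diff sphere_int_cmult sm sw smooth_intros sphere_int_frame)
    have "0 \<le> (sphere_int t (DE (\<lambda>z. (DE u z)\<^sup>2 - (DI u z)\<^sup>2)) + 2 * m * sphere_int t (DE (DE u))) / t"
      using ge eq t by (intro divide_nonneg_pos) auto
    then have "0 \<le> sphere_int t (DE (\<lambda>z. (DE u z)\<^sup>2 - (DI u z)\<^sup>2)) / t + 2 * m * (sphere_int t (DE (DE u)) / t)"
      by (simp add: add_divide_distrib)
    moreover have "(F has_real_derivative sphere_int t (DE (\<lambda>z. (DE u z)\<^sup>2 - (DI u z)\<^sup>2)) / t + 2 * m * (sphere_int t (DE (DE u)) / t)) (at t)"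
      unfolding F_def using t
      by (intro DERIV_add DERIV_cmult sphere_int_has_real_derivative smooth_intros u) auto
    ultimately show "\<exists>y. (F has_real_derivative y) (at t) \<and> 0 \<le> y" by blast
  qed (use R in simp)
  moreover have "F 0 = 0"
    by (simp add: F_def sphere_int_zero fieldderiv_zero u linear_cI linear_id[unfolded id_def])
  ultimately show "sphere_int R (flux_density u) \<le> 4 * m * sphere_int R (DE u)"
    using 1 2 by (simp add: F_def)
qed

section \<open>The Euclidean form and the estimate\<close>

lemma frechet_derivative_u0: "frechet_derivative u0 (at z) v = z \<bullet> v"
proof -
  have "(u0 has_derivative (\<lambda>v. z \<bullet> v)) (at z)"
    unfolding u0_def[abs_def] power2_norm_eq_inner
    by (auto intro!: derivative_eq_intros simp: inner_commute)
  then show ?thesis by (metis frechet_derivative_at)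
qed

lemma smooth_u0: "smooth u0"
proof -
  have "smooth (\<lambda>z::C2. z \<bullet> b)" for b
    unfolding smooth_def by (intro allI Ck_linear) (simp add: bounded_linear.linear bounded_linear_inner_left)
  then have "smooth (\<lambda>z::C2. (1/2) * (\<Sum>b\<in>Basis. (z \<bullet> b) * (z \<bullet> b)))"
    by (intro smooth_mult smooth_sum smooth_const)
  moreover have "u0 = (\<lambda>z. (1/2) * (\<Sum>b\<in>Basis. (z \<bullet> b) * (z \<bullet> b)))"
    by (rule ext) (simp add: u0_def power2_norm_eq_inner euclidean_inner[symmetric])
  ultimately show ?thesis by simp
qed

lemma hess_u0: "hess u0 z v w = v \<bullet> w"
proof -
  have "((\<lambda>x. x \<bullet> w) has_derivative (\<lambda>v. v \<bullet> w)) (at z)"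
    by (auto intro!: derivative_eq_intros)
  then show ?thesis
    unfolding hess_def frechet_derivative_u0 by (metis frechet_derivative_at)
qed

lemma MA_density_u0: "MA_density u0 z = 2"
  by (simp add: MA_density_eq[OF smooth_u0] omega_eq[OF smooth_u0] hess_u0 cI_axis inner_axis_axis inner_complex_def)

text \<open>The factor 2 is the constant value of \<open>MA_density u0\<close>; it cancels against
  the 2 in \<open>form_integral_MA\<close>.\<close>

lemma form_integral_u0:
  assumes "0 < R"
  shows "form_integral (ball 0 R) (wedge (omega u0) (omega u0)) = 2 * R ^ 4 * measure lborel (ball (0::C2) 1)"
proof -
  have "form_integral (ball 0 R) (wedge (omega u0) (omega u0)) = 2 * measure lborel (ball (0::C2) R)"
    by (simp add: form_integral_def set_lebesgue_integral_def MA_density_def[symmetric] MA_density_u0)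
  then show ?thesis
    using measure_lborel_ball[OF assms, where 'a = C2] by simp
qed

text \<open>At the origin the factor \<open>norm z\<close> makes both sides vanish whatever value
  \<open>radial_deriv\<close> takes there; elsewhere the ray through \<open>sgn z\<close> passes
  through \<open>z\<close> at time \<open>norm z\<close>.\<close>

lemma radial_deriv_eq:
  assumes "smooth u"
  shows "norm z * radial_deriv u z = fieldderiv (\<lambda>z. z) u z"
proof (cases "z = 0")
  case True
  then show ?thesis using assms by (simp add: fieldderiv_zero linear_id[unfolded id_def])
next
  case False
  have "((\<lambda>t. u (t *\<^sub>R sgn z)) has_real_derivative frechet_derivative u (at (norm z *\<^sub>R sgn z)) (sgn z)) (at (norm z))"
    using smooth_line_derivative[OF assms, of 0 "sgn z" "norm z" UNIV] by simp
  then have "radial_deriv u z = frechet_derivative u (at z) (sgn z)"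
    using False by (simp add: radial_deriv_def DERIV_imp_deriv sgn_div_norm)
  then show ?thesis
    using False by (simp add: fieldderiv_def sgn_div_norm linear_cmul[OF linear_frechet_derivative[OF assms]])
qed

theorem corollary3p8:
  fixes u :: "C2 \<Rightarrow> real" and R :: real
  assumes "smooth u" and "strictly_psh u" and "0 < R"
  shows "MA u (ball 0 R) / Vol (ball 0 R)
           = form_integral (ball 0 R) (wedge (omega u) (omega u))
             / form_integral (ball 0 R) (wedge (omega u0) (omega u0))
       \<and> form_integral (ball 0 R) (wedge (omega u) (omega u))
             / form_integral (ball 0 R) (wedge (omega u0) (omega u0))
           \<le> 8 / R ^ 3 * Linf_norm (cball 0 R) (\<lambda>z. norm z * radial_deriv u z)
               * sphere_average R (radial_deriv u)"
proof
  show "MA u (ball 0 R) / Vol (ball 0 R)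
           = form_integral (ball 0 R) (wedge (omega u) (omega u))
             / form_integral (ball 0 R) (wedge (omega u0) (omega u0))"
    by (simp add: MA_def Vol_def omega_def)
next
  define V where "V = measure lborel (ball (0::C2) 1)"
  define A where "A = sphere_int R (DE u)"
  define m where "m = Linf_norm (cball 0 R) (DE u)"
  have V: "0 < V"
    by (simp add: V_def content_ball_pos)
  have sp: "smooth (DE u)"
    by (intro smooth_frame assms)
  have m: "\<bar>DE u z\<bar> \<le> m" if "norm z \<le> R" for z
    unfolding m_def by (rule abs_le_Linf_norm[OF smooth_continuous_on[OF sp] assms(3) that])
  have "0 \<le> m"
    using m[of 0] assms(3) by simp
  note bound = flux_bound[OF assms m, folded A_def]
  \<comment> \<open>On the sphere \<open>radial_deriv u\<close> is \<open>DE u\<close> divided by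
    \<open>R\<close>, and \<open>V\<close> is the total mass in the normalisation of
    \<open>sphere_int\<close>.\<close>
  have avg: "sphere_average R (radial_deriv u) = A / (R * V)"
  proof -
    have "sphere_average R (radial_deriv u) = sphere_int R (\<lambda>z. (1/R) * DE u z) / V"
      unfolding V_def
    proof (rule sphere_average_eq[OF assms(3)])
      show "radial_deriv u z = (1/R) * DE u z" if "norm z = R" for z
        using radial_deriv_eq[OF assms(1), of z] that assms(3) by (simp add: field_simps)
    qed (intro smooth_continuous_on smooth_mult smooth_const sp)
    then show ?thesis
      by (simp only: sphere_int_cmult A_def) simp
  qed
  have "form_integral (ball 0 R) (wedge (omega u) (omega u)) / form_integral (ball 0 R) (wedge (omega u0) (omega u0))
      = sphere_int R (flux_density u) / (R ^ 4 * V)"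
    unfolding form_integral_MA[OF assms] form_integral_u0[OF assms(3)] V_def[symmetric] by simp
  also have "\<dots> \<le> (8 * m * A) / (R ^ 4 * V)"
  proof (rule divide_right_mono)
    \<comment> \<open>\<open>flux_bound\<close> gives \<open>4 * m * A\<close>; nonnegativity
      relaxes it to \<open>8 * m * A\<close>.\<close>
    have "0 \<le> m * A" using \<open>0 \<le> m\<close> bound(2) by simp
    then show "sphere_int R (flux_density u) \<le> 8 * m * A"
      using bound(1) by linarith
  qed (use V assms(3) in simp)
  also have "\<dots> = 8 / R ^ 3 * m * (A / (R * V))"
    using assms(3) by (simp add: field_simps power_eq_if)
  finally show "form_integral (ball 0 R) (wedge (omega u) (omega u))
             / form_integral (ball 0 R) (wedge (omega u0) (omega u0))
           \<le> 8 / R ^ 3 * Linf_norm (cball 0 R) (\<lambda>z. norm z * radial_deriv u z)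
               * sphere_average R (radial_deriv u)"
    unfolding avg m_def radial_deriv_eq[OF assms(1)] .
qed

end
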